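(* Let $k$ be a real number with $0<k\le 1$. Let $\rho_{AB_1\cdots B_{N-1}}$ be an $N$-qubit mixed state with $N\ge 4$, and let $1\le m\le N-3$. Suppose that $k\,\mathcal{C}_{AB_i}^2\ge \mathcal{C}_{A|B_{i+1}\cdots B_{N-1}}^2$ for $i=1,2,\ldots,m$, and $\mathcal{C}_{AB_j}^2\le k\,\mathcal{C}_{A|B_{j+1}\cdots B_{N-1}}^2$ for $j=m+1,\ldots,N-2$. Then for all $\beta\ge 4$, $$ \mathcal{C}^{\beta}_{A|B_1\cdots B_{N-1}} \ \ge\ \sum_{i=1}^{m-1}\Big(\prod_{j=1}^{i}\mathcal{M}_j\Big)\mathcal{C}^{\beta}_{AB_{i+1}}+\Big(\prod_{i=1}^{m}\mathcal{M}_i\Big)\Big(\prod_{j=m+1}^{N-2}\mathcal{Q}_j\,\mathcal{C}^{\beta}_{AB_j}+\mathcal{C}^{\beta}_{AB_{N-1}}\Big), $$ where $M=\frac{(1+k)^{\beta/2}-1}{k^{\beta/2}}+k^{\beta/2}$, $\mathcal{M}_i=M-\frac{\mathcal{C}^{\beta}_{A|B_{i+1}\cdots B_{N-1}}}{\mathcal{C}^{\beta}_{AB_i}}$ for $i=1,2,\ldots,m$, and $\mathcal{Q}_j=M-\frac{\mathcal{C}^{\beta}_{AB_j}}{\mathcal{C}^{\beta}_{A|B_{j+1}\cdots B_{N-1}}}$ for $j=m+1,\ldots,N-2$.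
   Context: An $N$-qubit mixed state is a density matrix (positive semidefinite, trace one) on $H_A\otimes H_{B_1}\otimes\cdots\otimes H_{B_{N-1}}$, where every factor is $\mathbb{C}^2$. For a bipartite pure state $|\psi\rangle_{XY}\in H_X\otimes H_Y$ the concurrence is $\mathcal{C}(|\psi\rangle_{XY})=\sqrt{2(1-\mathrm{tr}\,\rho_X^2)}$ with $\rho_X=\mathrm{tr}_Y|\psi\rangle\langle\psi|$. For a bipartite mixed state $\rho_{XY}$, $\mathcal{C}(\rho_{XY})=\min\sum_i p_i\,\mathcal{C}(|\psi_i\rangle)$, the minimum being over all pure state decompositions $\rho_{XY}=\sum_i p_i|\psi_i\rangle\langle\psi_i|$ with $p_i\ge 0$, $\sum_i p_i=1$. $\mathcal{C}_{AB_i}$ is the concurrence of the two-qubit reduced density matrix $\rho_{AB_i}$ of the given state (partial trace over all other subsystems). $\mathcal{C}_{A|B_{i}\cdots B_{N-1}}$ is the concurrence of the reduced density matrix on $A,B_i,\ldots,B_{N-1}$, viewed as a bipartite state under the bipartition $A$ versus $B_i\cdots B_{N-1}$; in particular $\mathcal{C}_{A|B_{N-1}}=\mathcal{C}_{AB_{N-1}}$. $\mathcal{C}^\beta_{\cdot}$ means $(\mathcal{C}_{\cdot})^\beta$. *)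

theory Defs
  imports "HOL-Analysis.Analysis"
begin

(* The qubits carry labels of type 'q.  The computational basis of the Hilbert space of a
   finite set S of qubits (one factor C^2 per label) is indexed by the bit assignments to S.
   State vectors and operators on S are coefficient functions; only their values on
   basis_states S are meaningful. *)

type_synonym 'q vec = "('q \<Rightarrow> bool) \<Rightarrow> complex"
type_synonym 'q oper = "('q \<Rightarrow> bool) \<Rightarrow> ('q \<Rightarrow> bool) \<Rightarrow> complex"

definition basis_states :: "'q set \<Rightarrow> ('q \<Rightarrow> bool) set" where
  "basis_states S = S \<rightarrow>\<^sub>E UNIV"

definition op_trace :: "'q set \<Rightarrow> 'q oper \<Rightarrow> complex" where
  "op_trace S A = (\<Sum>x\<in>basis_states S. A x x)"

definition op_mult :: "'q set \<Rightarrow> 'q oper \<Rightarrow> 'q oper \<Rightarrow> 'q oper" where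
  "op_mult S A B = (\<lambda>x y. \<Sum>z\<in>basis_states S. A x z * B z y)"

definition positive_semidefinite :: "'q set \<Rightarrow> 'q oper \<Rightarrow> bool" where
  "positive_semidefinite S A \<longleftrightarrow>
     (\<forall>x\<in>basis_states S. \<forall>y\<in>basis_states S. A y x = cnj (A x y)) \<and>
     (\<forall>v :: 'q vec. 0 \<le> Re (\<Sum>x\<in>basis_states S. \<Sum>y\<in>basis_states S. cnj (v x) * A x y * v y))"

definition density_matrix :: "'q set \<Rightarrow> 'q oper \<Rightarrow> bool" where
  "density_matrix S \<rho> \<longleftrightarrow> positive_semidefinite S \<rho> \<and> op_trace S \<rho> = 1"

definition pure_state :: "'q set \<Rightarrow> 'q vec \<Rightarrow> bool" where
  "pure_state S \<psi> \<longleftrightarrow> (\<Sum>x\<in>basis_states S. (cmod (\<psi> x))\<^sup>2) = 1"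

definition projector :: "'q vec \<Rightarrow> 'q oper" where
  "projector \<psi> = (\<lambda>x y. \<psi> x * cnj (\<psi> y))"

(* Reduction of an operator on S to the subsystem X \<subseteq> S, tracing out S - X;
   merge X (S - X) (x, z) is the basis state |x>|z> of S. *)
definition reduced :: "'q set \<Rightarrow> 'q set \<Rightarrow> 'q oper \<Rightarrow> 'q oper" where
  "reduced S X A = (\<lambda>x y. \<Sum>z\<in>basis_states (S - X).
     A (merge X (S - X) (x, z)) (merge X (S - X) (y, z)))"

(* Concurrence of a pure state on X \<union> Y under the bipartition X | Y (X, Y disjoint). *)
definition concurrence_pure :: "'q set \<Rightarrow> 'q set \<Rightarrow> 'q vec \<Rightarrow> real" where
  "concurrence_pure X Y \<psi> =
     (let \<rho>X = reduced (X \<union> Y) X (projector \<psi>)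
      in sqrt (2 * (1 - Re (op_trace X (op_mult X \<rho>X \<rho>X)))))"

definition pure_decomposition ::
    "'q set \<Rightarrow> 'q oper \<Rightarrow> nat \<Rightarrow> (nat \<Rightarrow> real) \<Rightarrow> (nat \<Rightarrow> 'q vec) \<Rightarrow> bool" where
  "pure_decomposition S \<rho> n p \<psi> \<longleftrightarrow>
     (\<forall>i<n. 0 \<le> p i \<and> pure_state S (\<psi> i)) \<and>
     (\<Sum>i<n. p i) = 1 \<and>
     (\<forall>x\<in>basis_states S. \<forall>y\<in>basis_states S.
        \<rho> x y = (\<Sum>i<n. of_real (p i) * projector (\<psi> i) x y))"

(* Concurrence of a density matrix on X \<union> Y under the bipartition X | Y.  The set of values is
   nonempty (spectral theorem) and bounded below by 0, and its infimum is attained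
   (compactness), so Inf is the minimum. *)
definition concurrence :: "'q set \<Rightarrow> 'q set \<Rightarrow> 'q oper \<Rightarrow> real" where
  "concurrence X Y \<rho> =
     Inf {\<Sum>i<n. p i * concurrence_pure X Y (\<psi> i) | n p \<psi>. pure_decomposition (X \<union> Y) \<rho> n p \<psi>}"

(* N-qubit states live on the labels 0, ..., N - 1, where 0 stands for A and i for B_i. *)

definition C_pair :: "nat \<Rightarrow> nat oper \<Rightarrow> nat \<Rightarrow> real" where
  \<comment> \<open>concurrence of A and B_i\<close>
  "C_pair N \<rho> i = concurrence {0} {i} (reduced {..<N} {0, i} \<rho>)"

definition C_rest :: "nat \<Rightarrow> nat oper \<Rightarrow> nat \<Rightarrow> real" where
  \<comment> \<open>concurrence of A versus B_i, ..., B_(N-1)\<close>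
  "C_rest N \<rho> i = concurrence {0} {i..N - 1} (reduced {..<N} ({0} \<union> {i..N - 1}) \<rho>)"

definition M_const :: "real \<Rightarrow> real \<Rightarrow> real" where
  "M_const k \<beta> = ((1 + k) powr (\<beta> / 2) - 1) / k powr (\<beta> / 2) + k powr (\<beta> / 2)"

(* If a denominator below vanishes, the quotient is 0 by convention.  Under the hypothesis
   k * (C_pair N \<rho> i)\<^sup>2 \<ge> (C_rest N \<rho> (i + 1))\<^sup>2, respectively
   (C_pair N \<rho> j)\<^sup>2 \<le> k * (C_rest N \<rho> (j + 1))\<^sup>2, this happens only if the numerator
   vanishes as well. *)

definition M_coeff :: "real \<Rightarrow> real \<Rightarrow> nat \<Rightarrow> nat oper \<Rightarrow> nat \<Rightarrow> real" where
  "M_coeff k \<beta> N \<rho> i = M_const k \<beta> - C_rest N \<rho> (i + 1) powr \<beta> / C_pair N \<rho> i powr \<beta>"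

definition Q_coeff :: "real \<Rightarrow> real \<Rightarrow> nat \<Rightarrow> nat oper \<Rightarrow> nat \<Rightarrow> real" where
  "Q_coeff k \<beta> N \<rho> j = M_const k \<beta> - C_pair N \<rho> j powr \<beta> / C_rest N \<rho> (j + 1) powr \<beta>"

end

(* The heart of the matter is the monogamy inequality
   C(A|BC)^2 >= C(AB)^2 + C(A|C)^2 for qubits A, B and an arbitrary system C.  The triangle
   inequality in R^2, applied to a pure state decomposition, reduces it to pure states, where upper
   bounds on C(AB) and C(A|C) suffice, that is, good ensembles for the two reduced states.
   Write rho_AB = sum_i X_i X_i^* with four 2x2 amplitude matrices X_i, and let
   E(Z) = sum_i X_i Z X_i^*.  Takagi diagonalisation makes the X_i orthogonal for the polarisation of
   det, and Hadamard mixing of them gives an ensemble of rho_AB of concurrence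
   c = 2 |d_1 - d_2 - d_3 + d_4|, d_i = |det X_i|.  In the eigenframe a, b of X_1^{-1} X_2 the matrices
   X_1, X_2 are diagonal and X_3, X_4 antidiagonal, so 4 det E <= c^2 det on the plane of all
   x a b^* + h.c.  From this plane one gets a traceless N with N^2 = 1, with E(N) orthogonal to E(1)
   and 4 det E(N) <= - c^2; measuring B in the eigenbasis of N steers A|C to an ensemble of squared
   concurrence 4 det E(1) + 4 det E(N) <= C(A|BC)^2 - c^2.

   The hierarchy then follows from (1+x)^mu >= 1 + (M - x^mu) x^mu for 0 <= x <= k, mu = beta/2 >= 2.
   The claimed bound is weaker than what this gives: the term C(AB_1)^beta is dropped, and the product
   over j stands in place of a sum, which is harmless since all its factors lie in [0,1]. *)

theory Submission
  imports Defs
begin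

section \<open>Two-by-two matrices and Takagi diagonalisation\<close>

text \<open>No formula for C(A|C) is at hand when C is larger than a qubit, so explicit ensembles
  must bound it. If the state of ABC is pure, each outcome of a measurement of B leaves a pure state
  of AC, and its concurrence is a determinant of the conditional state of A, which depends on rho_AB
  alone. So the whole question becomes one about two qubits. The projections P = (1 + N)/2 and Q =
  (1 - N)/2 have 4 det E(P) = 4 det E(Q) exactly when E(N) is orthogonal to E(1); this is what makes
  the sum of the two square roots explicit. A plane is needed because one real dimension is spent on
  this condition. The number c may exceed the concurrence of rho_AB, which for decreasing d_i is 2
  max(0, d_1 - d_2 - d_3 - d_4); an upper bound suffices, provided that the same c measures the
  negativity of det E. Below, c stands without the factor 2 until states reappear. M is the value at
  x = k of ((1+x)^mu - 1)/x^mu + x^mu, the coefficient that makes the power inequality an equality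
  at x.\<close>

type_synonym mat2 = "bool \<Rightarrow> bool \<Rightarrow> complex"

definition det2 :: "mat2 \<Rightarrow> complex" where
  "det2 X = X False False * X True True - X False True * X True False"

text \<open>Up to sign this is the spin-flip form \<open>X^T (sigma_y tensor sigma_y) Y\<close> of
  two-qubit vectors. Once its matrix on a family \<open>F\<close> is diagonal, the moduli of the
  diagonal entries are Wootters' numbers lambda_i.\<close>

definition polar2 :: "mat2 \<Rightarrow> mat2 \<Rightarrow> complex" where
  "polar2 X Y = X False False * Y True True + X True True * Y False False
     - X False True * Y True False - X True False * Y False True"

lemma polar2_self: "polar2 X X = 2 * det2 X"
  by (simp add: polar2_def det2_def)

lemma polar2_commute: "polar2 X Y = polar2 Y X"
  by (simp add: polar2_def)

lemma polar2_comb_left: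
  "polar2 (\<lambda>a b. s * X a b + t * Y a b) Z = s * polar2 X Z + t * polar2 Y Z"
  by (simp add: polar2_def algebra_simps)

lemma polar2_comb_right:
  "polar2 Z (\<lambda>a b. s * X a b + t * Y a b) = s * polar2 Z X + t * polar2 Z Y"
  by (simp add: polar2_def algebra_simps)

section \<open>Compactness of the amplitude families of a fixed two-qubit operator\<close>

lemma compact_fun_space:
  fixes K :: "'i \<Rightarrow> 'a::topological_space set"
  assumes "\<And>i. compact (K i)"
  shows "compact {f. \<forall>i. f i \<in> K i}"
proof -
  have "{f. \<forall>i. f i \<in> K i} = PiE UNIV K" by auto
  moreover have "compactin (product_topology (\<lambda>i. euclidean) UNIV) (PiE UNIV K)"
    unfolding compactin_PiE using assms by auto
  ultimately show ?thesis
    by (simp add: euclidean_product_topology)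
qed

lemma continuous_on_entry: "continuous_on A (\<lambda>F :: 'i \<Rightarrow> mat2. F i a b)"
proof -
  have "continuous_on A (\<lambda>F :: 'i \<Rightarrow> mat2. F i)"
    by (rule continuous_on_product_coordinates[THEN continuous_on_subset]) simp
  from continuous_on_product_then_coordinatewise[OF continuous_on_product_then_coordinatewise[OF this]]
  show ?thesis .
qed

text \<open>Both families are amplitudes of one two-qubit operator. This relation takes the place of
  mixing by a unitary matrix: no unitary has to be named, and the families related to a given one
  form a compact set.\<close>

definition same_gram :: "('i::finite \<Rightarrow> mat2) \<Rightarrow> ('i \<Rightarrow> mat2) \<Rightarrow> bool" where
  "same_gram F G \<longleftrightarrow> (\<forall>a b a' b'. (\<Sum>i\<in>UNIV. F i a b * cnj (F i a' b')) = (\<Sum>i\<in>UNIV. G i a b * cnj (G i a' b')))"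

lemma compact_same_gram: "compact {F. same_gram F G}"
proof -
  define R where "R a b a' b' = (\<Sum>i\<in>UNIV. G i a b * cnj (G i a' b'))" for a b a' b'
  have eq: "{F. same_gram F G} = (\<Inter>a. \<Inter>b. \<Inter>a'. \<Inter>b'. {F. (\<Sum>i\<in>UNIV. F i a b * cnj (F i a' b')) = R a b a' b'})"
    by (auto simp: same_gram_def R_def)
  have cl: "closed {F. same_gram F G}"
    unfolding eq by (intro closed_INT ballI closed_Collect_eq continuous_intros continuous_on_entry)
  let ?K = "{F :: 'a \<Rightarrow> mat2. \<forall>i. F i \<in> {X. \<forall>a. X a \<in> {Y. \<forall>b. Y b \<in> cball 0 (sqrt (Re (R a b a b)))}}}"
  have K: "compact ?K"
    by (intro compact_fun_space compact_cball)
  have "{F. same_gram F G} \<subseteq> ?K"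
  proof clarify
    fix F i a b assume F: "same_gram F G"
    have "(cmod (F i a b))\<^sup>2 \<le> (\<Sum>i\<in>UNIV. (cmod (F i a b))\<^sup>2)"
      by (intro member_le_sum) auto
    also have "\<dots> = Re (\<Sum>i\<in>UNIV. F i a b * cnj (F i a b))"
      by (simp add: complex_mult_cnj cmod_power2)
    also have "\<dots> = Re (R a b a b)"
      using F by (simp add: same_gram_def R_def)
    finally have "cmod (F i a b) \<le> sqrt (Re (R a b a b))"
      by (simp add: real_le_rsqrt)
    then show "F i a b \<in> cball 0 (sqrt (Re (R a b a b)))" by simp
  qed
  then show ?thesis
    using compact_Int_closed[OF K cl] by (simp add: Int_absorb1)
qed

text \<open>The phase \<open>u\<close> aligns \<open>u * polar2 X Y\<close> with
  \<open>polar2 X X\<close>. If the term of \<open>polar2 Y Y\<close> is as harmful as its bound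
  permits, what remains is the quadratic form of the real matrix ((alpha, gamma), (gamma, -alpha))
  of the moduli at the vector (c, s). The half-angle chosen here is its top eigenvector, with
  eigenvalue h = sqrt(alpha^2 + gamma^2) > alpha.\<close>

lemma rotate_increases_polar:
  fixes X Y :: mat2
  assumes "polar2 X Y \<noteq> 0" "cmod (polar2 Y Y) \<le> cmod (polar2 X X)"
  obtains c s :: real and u :: complex where "c\<^sup>2 + s\<^sup>2 = 1" "cmod u = 1"
    "cmod (polar2 X X) < cmod (polar2 (\<lambda>a b. c * X a b + (s * u) * Y a b) (\<lambda>a b. c * X a b + (s * u) * Y a b))"
proof -
  define \<alpha> where "\<alpha> = polar2 X X"
  define \<gamma> where "\<gamma> = polar2 X Y"
  define \<delta> where "\<delta> = polar2 Y Y"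
  define v where "v = (if \<alpha> = 0 then 1 else sgn \<alpha>)"
  define u where "u = v * cnj (sgn \<gamma>)"
  have v: "cmod v = 1" "\<alpha> = cmod \<alpha> * v"
    by (simp_all add: v_def norm_sgn) (simp add: sgn_eq)
  have g: "\<gamma> \<noteq> 0" using assms by (simp add: \<gamma>_def)
  have sg: "sgn \<gamma> * cnj (sgn \<gamma>) = 1" "\<gamma> = cmod \<gamma> * sgn \<gamma>" "cmod (sgn \<gamma>) = 1"
    using g by (simp_all add: complex_norm_square[symmetric] norm_sgn) (simp add: sgn_eq)
  have u: "cmod u = 1" using v sg by (simp add: u_def norm_mult)
  have "u * \<gamma> = cmod \<gamma> * v * (sgn \<gamma> * cnj (sgn \<gamma>))"
    by (subst (1) sg(2)) (simp add: u_def mult_ac)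
  then have ug: "u * \<gamma> = cmod \<gamma> * v" using sg by simp
  define h where "h = sqrt ((cmod \<alpha>)\<^sup>2 + (cmod \<gamma>)\<^sup>2)"
  have h: "h > 0" "h\<^sup>2 = (cmod \<alpha>)\<^sup>2 + (cmod \<gamma>)\<^sup>2" "cmod \<alpha> < h"
    using g by (auto simp: h_def intro!: add_nonneg_pos real_less_rsqrt)
  have "(cmod \<alpha> / h)\<^sup>2 + (cmod \<gamma> / h)\<^sup>2 = 1"
    using h(1) by (simp add: power_divide add_divide_distrib[symmetric] flip: h(2))
  then obtain t where t: "cmod \<alpha> / h = cos t" "cmod \<gamma> / h = sin t"
    using sincos_total_2pi by metis
  define c where "c = cos (t/2)"
  define s where "s = sin (t/2)"
  have cs: "c\<^sup>2 + s\<^sup>2 = 1" by (simp add: c_def s_def)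
  have d: "c\<^sup>2 - s\<^sup>2 = cmod \<alpha> / h" "2 * c * s = cmod \<gamma> / h"
    using cos_double[of "t/2"] sin_double[of "t/2"] t by (simp_all add: c_def s_def)
  let ?Z = "\<lambda>a b. c * X a b + (s * u) * Y a b"
  have "polar2 ?Z ?Z = c\<^sup>2 * \<alpha> + 2 * c * s * (u * \<gamma>) + s\<^sup>2 * u\<^sup>2 * \<delta>"
    unfolding polar2_comb_left polar2_comb_right polar2_commute[of Y X] \<alpha>_def \<gamma>_def \<delta>_def
    by (simp add: algebra_simps power2_eq_square)
  also have "\<dots> = (c\<^sup>2 * cmod \<alpha> + 2 * c * s * cmod \<gamma>) * v + s\<^sup>2 * u\<^sup>2 * \<delta>"
    unfolding ug by (subst v(2)) (simp add: algebra_simps)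
  finally have Z: "polar2 ?Z ?Z = complex_of_real (c\<^sup>2 * cmod \<alpha> + 2 * c * s * cmod \<gamma>) * v + s\<^sup>2 * u\<^sup>2 * \<delta>"
    by simp
  have "cmod (s\<^sup>2 * u\<^sup>2 * \<delta>) \<le> s\<^sup>2 * cmod \<alpha>"
    using u assms(2) by (auto simp: norm_mult norm_power \<alpha>_def \<delta>_def intro!: mult_left_mono)
  moreover have "c\<^sup>2 * cmod \<alpha> + 2 * c * s * cmod \<gamma> \<le> cmod (complex_of_real (c\<^sup>2 * cmod \<alpha> + 2 * c * s * cmod \<gamma>) * v)"
    unfolding norm_mult v(1) norm_of_real by simp
  moreover have "cmod (complex_of_real (c\<^sup>2 * cmod \<alpha> + 2 * c * s * cmod \<gamma>) * v) - cmod (s\<^sup>2 * u\<^sup>2 * \<delta>) \<le> cmod (polar2 ?Z ?Z)"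
    unfolding Z by (metis norm_diff_ineq)
  moreover have "(c\<^sup>2 - s\<^sup>2) * cmod \<alpha> + 2 * c * s * cmod \<gamma> = h"
  proof -
    have "(c\<^sup>2 - s\<^sup>2) * cmod \<alpha> + 2 * c * s * cmod \<gamma> = h\<^sup>2 / h"
      unfolding d h(2) by (simp add: power2_eq_square add_divide_distrib)
    then show ?thesis using h by (simp add: power2_eq_square)
  qed
  ultimately have "h \<le> cmod (polar2 ?Z ?Z)" by (simp add: algebra_simps)
  then show thesis using h that[OF cs u] unfolding \<alpha>_def by linarith
qed

lemma same_gram_pair_update:
  assumes ij: "i \<noteq> j"
    and eq: "\<And>a b a' b'. X a b * cnj (X a' b') + Y a b * cnj (Y a' b')
        = F i a b * cnj (F i a' b') + F j a b * cnj (F j a' b')"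
  shows "same_gram (F(i := X, j := Y)) F"
  unfolding same_gram_def
proof (intro allI)
  fix a b a' b'
  have split: "(\<Sum>k\<in>UNIV. f k) = f i + f j + (\<Sum>k\<in>UNIV - {i, j}. f k)" for f :: "'a \<Rightarrow> complex"
    using ij by (subst sum.subset_diff[of "{i, j}"]) (auto simp: add.commute)
  show "(\<Sum>k\<in>UNIV. (F(i := X, j := Y)) k a b * cnj ((F(i := X, j := Y)) k a' b')) = (\<Sum>k\<in>UNIV. F k a b * cnj (F k a' b'))"
    unfolding split using ij eq by auto
qed

text \<open>One index after the other, \<open>F i\<close> is chosen to maximise \<open>\<bar>polar2 (F i) (F i)\<bar>\<close>; a nonzero
  off-diagonal entry could be rotated away at a gain.\<close>

lemma takagi:
  fixes G :: "'i::finite \<Rightarrow> mat2"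
  obtains F where "same_gram F G" "\<And>i j. i \<noteq> j \<Longrightarrow> polar2 (F i) (F j) = 0"
proof -
  \<comment> \<open>The indices in \<open>J\<close> are already decoupled from all others, so any
    mixing of two indices outside \<open>J\<close> leaves them decoupled.\<close>
  define V where "V J = {F. same_gram F G \<and> (\<forall>i\<in>J. \<forall>j. j \<noteq> i \<longrightarrow> polar2 (F i) (F j) = 0)}" for J
  have cont: "continuous_on A (\<lambda>F :: 'i \<Rightarrow> mat2. polar2 (F i) (F j))" for A i j
    unfolding polar2_def by (intro continuous_intros continuous_on_entry)
  have compV: "compact (V J)" for J
  proof -
    have "V J = {F. same_gram F G} \<inter> (\<Inter>i\<in>J. \<Inter>j\<in>-{i}. {F. polar2 (F i) (F j) = 0})"
      by (auto simp: V_def)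
    moreover have "closed (\<Inter>i\<in>J. \<Inter>j\<in>-{i}. {F :: 'i \<Rightarrow> mat2. polar2 (F i) (F j) = 0})"
      by (intro closed_INT ballI closed_Collect_eq continuous_intros cont)
    ultimately show ?thesis using compact_same_gram[of G] by (simp add: compact_Int_closed)
  qed
  have "V J \<noteq> {}" for J :: "'i set"
    using finite[of J]
  proof (induction J rule: finite_induct)
    case empty
    show ?case by (auto simp: V_def same_gram_def)
  next
    case (insert i J)
    have "\<exists>F\<in>V J. \<forall>H\<in>V J. cmod (polar2 (H i) (H i)) \<le> cmod (polar2 (F i) (F i))"
      by (rule continuous_attains_sup[OF compV insert.IH continuous_on_norm[OF cont]])
    then obtain F where F: "F \<in> V J" "\<And>H. H \<in> V J \<Longrightarrow> cmod (polar2 (H i) (H i)) \<le> cmod (polar2 (F i) (F i))"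
      by metis
    have upd: "F(i := X, j := Y) \<in> V J"
      if "j \<noteq> i" "j \<notin> J"
        and eq: "\<And>a b a' b'. X a b * cnj (X a' b') + Y a b * cnj (Y a' b')
          = F i a b * cnj (F i a' b') + F j a b * cnj (F j a' b')"
        and X: "X = (\<lambda>a b. x * F i a b + x' * F j a b)" and Y: "Y = (\<lambda>a b. y * F i a b + y' * F j a b)"
      for j X Y x x' y y'
    proof -
      have "same_gram (F(i := X, j := Y)) F" using that by (intro same_gram_pair_update) auto
      then have "same_gram (F(i := X, j := Y)) G" using F(1) by (simp add: V_def same_gram_def)
      moreover have "polar2 (F k) X = 0" "polar2 (F k) Y = 0" if "k \<in> J" for k
      proof -
        have "polar2 (F k) (F i) = 0" "polar2 (F k) (F j) = 0"
          using F(1) that \<open>i \<notin> J\<close> \<open>j \<notin> J\<close> by (auto simp: V_def)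
        then show "polar2 (F k) X = 0" "polar2 (F k) Y = 0"
          unfolding X Y polar2_comb_right by simp_all
      qed
      ultimately show ?thesis
        using F(1) \<open>i \<notin> J\<close> \<open>j \<notin> J\<close> by (auto simp: V_def)
    qed
    have "polar2 (F i) (F j) = 0" if ji: "j \<noteq> i" for j
    proof (rule ccontr)
      assume nz: "polar2 (F i) (F j) \<noteq> 0"
      then have jJ: "j \<notin> J" using F(1) ji by (auto simp: V_def polar2_commute[of "F i"])
      \<comment> \<open>A swap is also an admissible mixing, so maximality at \<open>i\<close>
        yields the comparison of sizes that \<open>rotate_increases_polar\<close> demands.\<close>
      have "F(i := F j, j := F i) \<in> V J"
        using ji jJ by (intro upd[where x=0 and x'=1 and y=1 and y'=0]) auto
      from F(2)[OF this] have le: "cmod (polar2 (F j) (F j)) \<le> cmod (polar2 (F i) (F i))"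
        using ji by simp
      obtain c s :: real and u :: complex where u: "c\<^sup>2 + s\<^sup>2 = 1" "cmod u = 1"
        and less: "cmod (polar2 (F i) (F i)) < cmod (polar2 (\<lambda>a b. c * F i a b + (s * u) * F j a b) (\<lambda>a b. c * F i a b + (s * u) * F j a b))"
        by (rule rotate_increases_polar[OF nz le])
      let ?X = "\<lambda>a b. c * F i a b + (s * u) * F j a b"
      let ?Y = "\<lambda>a b. (- s) * F i a b + (c * u) * F j a b"
      have uu: "u * cnj u = 1" using u by (simp add: complex_norm_square[symmetric])
      have cs: "complex_of_real c * c + complex_of_real s * s = 1"
        using u(1) by (metis of_real_1 of_real_add of_real_mult power2_eq_square)
      have "?X a b * cnj (?X a' b') + ?Y a b * cnj (?Y a' b')
          = F i a b * cnj (F i a' b') + F j a b * cnj (F j a' b')" for a b a' b'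
      proof -
        have "?X a b * cnj (?X a' b') + ?Y a b * cnj (?Y a' b')
          = (complex_of_real c * c + complex_of_real s * s) * (F i a b * cnj (F i a' b'))
            + (complex_of_real c * c + complex_of_real s * s) * (u * cnj u) * (F j a b * cnj (F j a' b'))"
          by (simp add: algebra_simps)
        then show ?thesis by (simp add: uu cs)
      qed
      then have "F(i := ?X, j := ?Y) \<in> V J"
        by (rule upd[OF ji jJ _ refl refl])
      from F(2)[OF this] less ji show False by simp
    qed
    then have "F \<in> V (insert i J)" using F(1) by (auto simp: V_def)
    then show ?case by blast
  qed
  then obtain F where "F \<in> V UNIV" by blast
  then show thesis using that by (auto simp: V_def)
qed

section \<open>Matrices acting on vectors, and the negative plane\<close>

type_synonym vec2 = "bool \<Rightarrow> complex"

definition vdet :: "vec2 \<Rightarrow> vec2 \<Rightarrow> complex" where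
  "vdet u v = u False * v True - u True * v False"

definition mat_vec :: "mat2 \<Rightarrow> vec2 \<Rightarrow> vec2" where
  "mat_vec X u = (\<lambda>s. X s False * u False + X s True * u True)"

definition outer :: "vec2 \<Rightarrow> vec2 \<Rightarrow> mat2" where
  "outer u v = (\<lambda>s t. u s * cnj (v t))"

text \<open>If \<open>F\<close> lists the amplitudes of a two-qubit state, \<open>sandwich F (outer z z)\<close> is the
  unnormalised state of the first qubit after the outcome \<open>z\<close> on the second.\<close>

definition sandwich :: "('i::finite \<Rightarrow> mat2) \<Rightarrow> mat2 \<Rightarrow> mat2" where
  "sandwich F Z = (\<lambda>s t. \<Sum>p\<in>UNIV. \<Sum>q\<in>UNIV. (\<Sum>i\<in>UNIV. F i s p * cnj (F i t q)) * Z p q)"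

lemma vdet_mat_vec: "vdet (mat_vec X u) (mat_vec X v) = det2 X * vdet u v"
  by (simp add: vdet_def mat_vec_def det2_def algebra_simps)

text \<open>The polarisation of \<open>vdet_mat_vec\<close>. It turns orthogonality of two amplitude
  matrices into a linear relation between the images of a frame under them.\<close>

lemma vdet_mat_vec_polar:
  "vdet (mat_vec X u) (mat_vec Y v) + vdet (mat_vec Y u) (mat_vec X v) = polar2 X Y * vdet u v"
  by (simp add: vdet_def mat_vec_def polar2_def algebra_simps)

lemma vdet_zero_imp_multiple:
  assumes "vdet u v = 0" "u \<noteq> (\<lambda>_. 0)"
  obtains c where "v = (\<lambda>s. c * u s)"
proof (cases "u False = 0")
  case True
  then have "u True \<noteq> 0" using assms(2) by (auto simp: fun_eq_iff) (metis (full_types))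
  then have "v s = (v True / u True) * u s" for s
    using True assms(1) by (cases s) (auto simp: vdet_def)
  then show ?thesis using that by blast
next
  case False
  then have "v s = (v False / u False) * u s" for s
    using assms(1) by (cases s) (auto simp: vdet_def field_simps)
  then show ?thesis using that by blast
qed

lemma singular_kernel:
  assumes "det2 X = 0"
  obtains u where "u \<noteq> (\<lambda>_. 0)" "mat_vec X u = (\<lambda>_. 0)"
proof -
  have bool_fun: "f = (\<lambda>_. 0) \<longleftrightarrow> f False = 0 \<and> f True = 0" for f :: vec2
    by (auto simp: fun_eq_iff) (metis (full_types))
  \<comment> \<open>\<open>?u\<close> is annihilated by the first row of \<open>X\<close> and
    \<open>?v\<close> by the second; a singular \<open>X\<close> annihilates both. If both are zero,
    so is \<open>X\<close>, and any vector will do.\<close>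
  let ?u = "\<lambda>s. if s then - X False False else X False True"
  let ?v = "\<lambda>s. if s then - X True False else X True True"
  let ?w = "\<lambda>s::bool. 1 :: complex"
  have "mat_vec X ?u = (\<lambda>_. 0)" "mat_vec X ?v = (\<lambda>_. 0)"
    using assms unfolding bool_fun by (auto simp: mat_vec_def det2_def algebra_simps)
  moreover have "mat_vec X ?w = (\<lambda>_. 0)" if "?u = (\<lambda>_. 0)" "?v = (\<lambda>_. 0)"
    using that unfolding bool_fun by (auto simp: mat_vec_def)
  moreover have "?w \<noteq> (\<lambda>_. 0)" by (simp add: fun_eq_iff)
  ultimately show ?thesis using that by metis
qed

lemma sandwich_outer:
  "sandwich F (outer u v) = (\<lambda>s t. \<Sum>i\<in>UNIV. mat_vec (F i) u s * cnj (mat_vec (F i) v t))"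
  by (intro ext) (simp add: sandwich_def outer_def mat_vec_def UNIV_bool sum_distrib_left
      sum.distrib[symmetric] algebra_simps)

lemma sandwich_comb:
  "sandwich F (\<lambda>p q. x * Z p q + y * W p q) = (\<lambda>s t. x * sandwich F Z s t + y * sandwich F W s t)"
  by (intro ext) (simp add: sandwich_def UNIV_bool algebra_simps)

lemma sandwich_same_gram: "same_gram F G \<Longrightarrow> sandwich F = sandwich G"
  by (intro ext) (simp add: sandwich_def same_gram_def)

lemma sandwich_adjoint:
  "sandwich F (\<lambda>p q. cnj (Z q p)) s t = cnj (sandwich F Z t s)"
  by (simp add: sandwich_def UNIV_bool mult.commute add_ac)

section \<open>The plane on which the determinant of the sandwich is negative\<close>

lemma det2_hermitian_outer:
  "det2 (\<lambda>s t. y * outer e f s t + cnj y * outer f e s t) = - of_real ((cmod y)\<^sup>2 * (cmod (vdet e f))\<^sup>2)"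
  unfolding of_real_mult complex_norm_square
  by (simp add: det2_def outer_def vdet_def algebra_simps)

text \<open>Orthogonality makes F_i^{-1} F_j traceless, so its eigenvalues are t and -t, with
  eigenvectors \<open>a\<close> and \<open>b\<close>. Read from the frame \<open>a\<close>,
  \<open>b\<close> to the frame e = F_i a, f = F_i b, the matrix \<open>F i\<close> is the identity,
  \<open>F j\<close> is diag(t, -t), and orthogonality to these two forces \<open>F k\<close> and
  \<open>F l\<close> to be antidiagonal. Hence the sandwich of x a b^* + h.c. is y e f^* + h.c., of
  determinant - |y|^2 |vdet e f|^2. The two orderings settle the signs in the lower bound for
  |y|.\<close>

lemma x_state_frame:
  fixes F :: "'i::finite \<Rightarrow> mat2"
  assumes orth: "\<And>i j. i \<noteq> j \<Longrightarrow> polar2 (F i) (F j) = 0"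
    and dist: "distinct [i, j, k, l]" and univ: "UNIV = {i, j, k, l}"
    and nz: "det2 (F i) \<noteq> 0" "det2 (F j) \<noteq> 0"
    and ord: "cmod (det2 (F j)) \<le> cmod (det2 (F i))" "cmod (det2 (F l)) \<le> cmod (det2 (F k))"
  obtains a b where "vdet a b \<noteq> 0"
    "\<And>x. (cmod x)\<^sup>2 * (cmod (vdet a b))\<^sup>2 *
        (cmod (det2 (F i)) - cmod (det2 (F j)) - cmod (det2 (F k)) + cmod (det2 (F l)))\<^sup>2
      \<le> - Re (det2 (sandwich F (\<lambda>p q. x * outer a b p q + cnj x * outer b a p q)))"
proof -
  define t where "t = csqrt (- det2 (F j) / det2 (F i))"
  have t2: "t\<^sup>2 = - det2 (F j) / det2 (F i)" by (simp add: t_def)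
  have t0: "t \<noteq> 0" using t2 nz by auto
  have eig: "\<exists>a. a \<noteq> (\<lambda>_. 0) \<and> mat_vec (F j) a = (\<lambda>s. \<tau> * mat_vec (F i) a s)" if \<tau>: "\<tau>\<^sup>2 = t\<^sup>2" for \<tau>
  proof -
    have "polar2 (F i) (F j) = 0" using orth dist by simp
    then have "det2 (\<lambda>s p. 1 * F j s p + (- \<tau>) * F i s p) = det2 (F j) + \<tau>\<^sup>2 * det2 (F i)"
      by (simp add: det2_def polar2_def power2_eq_square algebra_simps) algebra
    also have "\<dots> = 0" using nz by (simp add: \<tau> t2)
    finally obtain a where a: "a \<noteq> (\<lambda>_. 0)" "mat_vec (\<lambda>s p. 1 * F j s p + (- \<tau>) * F i s p) a = (\<lambda>_. 0)"
      by (rule singular_kernel)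
    then have "mat_vec (F j) a s = \<tau> * mat_vec (F i) a s" for s
      by (auto simp: mat_vec_def fun_eq_iff algebra_simps)
    then show ?thesis using a(1) by blast
  qed
  obtain a where a: "a \<noteq> (\<lambda>_. 0)" "mat_vec (F j) a = (\<lambda>s. t * mat_vec (F i) a s)"
    using eig[of t] by auto
  obtain b where b: "b \<noteq> (\<lambda>_. 0)" "mat_vec (F j) b = (\<lambda>s. - t * mat_vec (F i) b s)"
    using eig[of "- t"] by auto
  define e where "e = mat_vec (F i) a"
  define f where "f = mat_vec (F i) b"
  have ab: "vdet a b \<noteq> 0"
  proof
    assume "vdet a b = 0"
    then obtain c where c: "b = (\<lambda>s. c * a s)" using vdet_zero_imp_multiple a(1) by blast
    with b(1) have c0: "c \<noteq> 0" by auto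
    have lin: "mat_vec X b = (\<lambda>s. c * mat_vec X a s)" for X
      by (simp add: c mat_vec_def algebra_simps)
    have "c * (t * e s) = - t * (c * e s)" for s
      using b(2) unfolding lin a(2) e_def by meson
    then have e0: "e s = 0" for s using c0 t0 by (simp add: eq_neg_iff_add_eq_0)
    have "vdet e v = 0" for v using e0 by (simp add: vdet_def)
    then have "vdet a v = 0" for v
      using vdet_mat_vec[of "F i" a v] nz by (simp add: e_def)
    from this[of "\<lambda>s. if s then 1 else 0"] this[of "\<lambda>s. if s then 0 else 1"]
    have "a False = 0" "a True = 0" by (auto simp: vdet_def)
    then have "a s = 0" for s by (cases s) auto
    then show False using a(1) by blast
  qed
  have ef: "vdet e f = det2 (F i) * vdet a b" by (simp add: e_def f_def vdet_mat_vec)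
  then have ef0: "vdet e f \<noteq> 0" using ab nz by simp
  then have e0: "e \<noteq> (\<lambda>_. 0)" and f0: "f \<noteq> (\<lambda>_. 0)" by (auto simp: vdet_def)
  have anti: "\<exists>p q. mat_vec (F n) a = (\<lambda>s. p * f s) \<and> mat_vec (F n) b = (\<lambda>s. q * e s)
      \<and> - p * q * det2 (F i) = det2 (F n)" if n: "n \<noteq> i" "n \<noteq> j" for n
  proof -
    let ?u = "mat_vec (F n) a" and ?v = "mat_vec (F n) b"
    have 1: "vdet e ?v + vdet ?u f = 0"
      using vdet_mat_vec_polar[of "F i" a "F n" b] orth[of i n] n by (simp add: e_def f_def)
    have "vdet (\<lambda>s. t * e s) ?v + vdet ?u (\<lambda>s. - t * f s) = 0"
      using vdet_mat_vec_polar[of "F j" a "F n" b] orth[of j n] n a(2) b(2) by (simp add: e_def f_def)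
    then have "t * (vdet e ?v - vdet ?u f) = 0" by (simp add: vdet_def algebra_simps)
    then have "vdet e ?v = vdet ?u f" using t0 by simp
    with 1 have 2: "vdet e ?v = 0" "vdet ?u f = 0" by simp_all
    obtain q where q: "?v = (\<lambda>s. q * e s)" using vdet_zero_imp_multiple[OF 2(1) e0] by blast
    have "vdet f ?u = 0" using 2(2) by (simp add: vdet_def mult.commute)
    then obtain p where p: "?u = (\<lambda>s. p * f s)" using vdet_zero_imp_multiple f0 by blast
    have "det2 (F n) * vdet a b = - p * q * vdet e f"
      using vdet_mat_vec[of "F n" a b] unfolding p q by (simp add: vdet_def algebra_simps)
    then have "(det2 (F n) + p * q * det2 (F i)) * vdet a b = 0" by (simp add: ef algebra_simps)
    then have "det2 (F n) = - p * q * det2 (F i)" using ab by (simp add: eq_neg_iff_add_eq_0)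
    then show ?thesis using p q by auto
  qed
  obtain p3 q3 where k: "mat_vec (F k) a = (\<lambda>s. p3 * f s)" "mat_vec (F k) b = (\<lambda>s. q3 * e s)"
    "- p3 * q3 * det2 (F i) = det2 (F k)" using anti[of k] dist by auto
  obtain p4 q4 where l: "mat_vec (F l) a = (\<lambda>s. p4 * f s)" "mat_vec (F l) b = (\<lambda>s. q4 * e s)"
    "- p4 * q4 * det2 (F i) = det2 (F l)" using anti[of l] dist by auto
  define di where "di = cmod (det2 (F i))"
  have di: "di > 0" using nz by (simp add: di_def)
  have dk: "cmod (det2 (F k)) = cmod p3 * cmod q3 * di" and dl: "cmod (det2 (F l)) = cmod p4 * cmod q4 * di"
    unfolding k(3)[symmetric] l(3)[symmetric] by (simp_all add: norm_mult di_def)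
  have dj: "cmod (det2 (F j)) = (cmod t)\<^sup>2 * di"
    using arg_cong[OF t2, of cmod] nz by (simp add: norm_power norm_divide di_def)
  \<comment> \<open>This is the orthogonality of \<open>F k\<close> and \<open>F l\<close>. It makes
    the two cross terms of |g|^2 real, negative and of full modulus, so that |g| is a difference and
    not merely bounded by a sum.\<close>
  have cross: "p3 * q4 = - (p4 * q3)"
  proof -
    have "vdet (\<lambda>s. p3 * f s) (\<lambda>s. q4 * e s) + vdet (\<lambda>s. p4 * f s) (\<lambda>s. q3 * e s) = 0"
      using vdet_mat_vec_polar[of "F k" a "F l" b] orth[of k l] dist by (simp add: k l)
    then have "(p3 * q4 + p4 * q3) * vdet e f = 0" by (simp add: vdet_def algebra_simps)
    then show ?thesis using ef0 by (simp add: eq_neg_iff_add_eq_0)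
  qed
  define g where "g = p3 * cnj q3 + p4 * cnj q4"
  have g: "cmod g = \<bar>cmod p3 * cmod q3 - cmod p4 * cmod q4\<bar>"
  proof -
    have "cmod p3 * cmod q4 = cmod p4 * cmod q3"
      using arg_cong[OF cross, of cmod] by (simp add: norm_mult)
    then have n: "(cmod p4 * cmod q3)\<^sup>2 = (cmod p3 * cmod q3) * (cmod p4 * cmod q4)"
      by (simp add: power2_eq_square)
    have "complex_of_real ((cmod g)\<^sup>2) = g * cnj g" by (rule complex_norm_square)
    also have "\<dots> = (p3 * cnj p3) * (q3 * cnj q3) + (p4 * cnj p4) * (q4 * cnj q4)
        + (p3 * q4) * cnj (p4 * q3) + cnj (p3 * q4) * (p4 * q3)"
      by (simp add: g_def algebra_simps)
    also have "\<dots> = complex_of_real ((cmod p3 * cmod q3)\<^sup>2 + (cmod p4 * cmod q4)\<^sup>2 - 2 * (cmod p4 * cmod q3)\<^sup>2)"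
      unfolding cross of_real_diff of_real_add of_real_mult power_mult_distrib complex_norm_square
      by (simp add: algebra_simps)
    also have "\<dots> = complex_of_real ((cmod p3 * cmod q3 - cmod p4 * cmod q4)\<^sup>2)"
      unfolding n by (simp add: power2_eq_square algebra_simps)
    finally have "(cmod g)\<^sup>2 = (cmod p3 * cmod q3 - cmod p4 * cmod q4)\<^sup>2"
      using of_real_eq_iff by blast
    then show ?thesis by (metis abs_norm_cancel power2_eq_iff abs_minus_cancel)
  qed
  show thesis
  proof (rule that[OF ab])
    fix x
    \<comment> \<open>\<open>F i\<close> and \<open>F j\<close> send a b^* to multiples of e f^*,
      with total coefficient 1 - |t|^2. \<open>F k\<close> and \<open>F l\<close> exchange the two
      directions and send it to g f e^*, so \<open>g\<close> reaches the coefficient of e f^*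
      conjugated, through the second summand.\<close>
    define y where "y = x * of_real (1 - (cmod t)\<^sup>2) + cnj x * cnj g"
    have sum4: "(\<Sum>n\<in>UNIV. h n) = h i + h j + h k + h l" for h :: "'i \<Rightarrow> complex"
      unfolding univ using dist by (simp add: add_ac)
    have tt: "complex_of_real ((cmod t)\<^sup>2) = t * cnj t" by (rule complex_norm_square)
    have "sandwich F (\<lambda>p q. x * outer a b p q + cnj x * outer b a p q)
        = (\<lambda>s r. y * outer e f s r + cnj y * outer f e s r)"
      unfolding sandwich_comb sandwich_outer sum4 a(2) b(2) k l e_def[symmetric] f_def[symmetric]
        y_def g_def of_real_diff tt
      by (intro ext) (simp add: outer_def algebra_simps)
    then have S: "- Re (det2 (sandwich F (\<lambda>p q. x * outer a b p q + cnj x * outer b a p q)))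
        = (cmod y)\<^sup>2 * (cmod (vdet e f))\<^sup>2"
      by (simp add: det2_hermitian_outer)
    have "cmod x * (1 - (cmod t)\<^sup>2) - cmod x * cmod g \<le> cmod y"
         "cmod x * cmod g - cmod x * (1 - (cmod t)\<^sup>2) \<le> cmod y"
    proof -
      have "(cmod t)\<^sup>2 \<le> 1" using ord(1) di unfolding dj di_def[symmetric] by simp
      then have "cmod (x * of_real (1 - (cmod t)\<^sup>2)) = cmod x * (1 - (cmod t)\<^sup>2)"
        by (simp only: norm_mult norm_of_real)
      moreover have "cmod (cnj x * cnj g) = cmod x * cmod g" by (simp add: norm_mult)
      ultimately show "cmod x * (1 - (cmod t)\<^sup>2) - cmod x * cmod g \<le> cmod y"
         "cmod x * cmod g - cmod x * (1 - (cmod t)\<^sup>2) \<le> cmod y"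
        unfolding y_def by (metis norm_diff_ineq, metis norm_diff_ineq add.commute)
    qed
    then have "\<bar>cmod x * (1 - (cmod t)\<^sup>2 - cmod g)\<bar> \<le> cmod y"
      by (simp add: abs_le_iff algebra_simps)
    then have y2: "(cmod x)\<^sup>2 * (1 - (cmod t)\<^sup>2 - cmod g)\<^sup>2 \<le> (cmod y)\<^sup>2"
      by (metis abs_le_square_iff abs_norm_cancel power_mult_distrib)
    have "cmod p4 * cmod q4 \<le> cmod p3 * cmod q3" using ord(2) di unfolding dk dl by simp
    then have "di - cmod (det2 (F j)) - cmod (det2 (F k)) + cmod (det2 (F l)) = (1 - (cmod t)\<^sup>2 - cmod g) * di"
      unfolding dj dk dl g by (simp add: algebra_simps)
    then have "(cmod x)\<^sup>2 * (cmod (vdet a b))\<^sup>2 *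
        (cmod (det2 (F i)) - cmod (det2 (F j)) - cmod (det2 (F k)) + cmod (det2 (F l)))\<^sup>2
      = ((cmod x)\<^sup>2 * (1 - (cmod t)\<^sup>2 - cmod g)\<^sup>2) * (cmod (vdet e f))\<^sup>2"
      unfolding di_def[symmetric] ef norm_mult by (simp add: power_mult_distrib)
    also have "\<dots> \<le> (cmod y)\<^sup>2 * (cmod (vdet e f))\<^sup>2"
      by (intro mult_right_mono y2) simp
    finally show "(cmod x)\<^sup>2 * (cmod (vdet a b))\<^sup>2 *
        (cmod (det2 (F i)) - cmod (det2 (F j)) - cmod (det2 (F k)) + cmod (det2 (F l)))\<^sup>2
      \<le> - Re (det2 (sandwich F (\<lambda>p q. x * outer a b p q + cnj x * outer b a p q)))"
      unfolding S .
  qed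
qed

lemma nonzero_vdet_partner:
  assumes "a \<noteq> (\<lambda>_. 0)"
  obtains b where "vdet a b \<noteq> 0"
proof -
  have "a False \<noteq> 0 \<or> a True \<noteq> 0" using assms by (auto simp: fun_eq_iff) (metis (full_types))
  then show thesis
    using that[of "\<lambda>s. if s then 1 else 0"] that[of "\<lambda>s. if s then 0 else 1"] by (auto simp: vdet_def)
qed

text \<open>The degenerate case, in which the eigenframe of \<open>x_state_frame\<close> need not exist: a common kernel
  vector takes its place.\<close>

lemma single_invertible_frame:
  fixes F :: "'i::finite \<Rightarrow> mat2"
  assumes orth: "\<And>i j. i \<noteq> j \<Longrightarrow> polar2 (F i) (F j) = 0"
    and nz: "det2 (F i) \<noteq> 0" and sing: "\<And>n. n \<noteq> i \<Longrightarrow> det2 (F n) = 0"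
  obtains a b where "vdet a b \<noteq> 0"
    "\<And>x. (cmod x)\<^sup>2 * (cmod (vdet a b))\<^sup>2 * (cmod (det2 (F i)))\<^sup>2
      = - Re (det2 (sandwich F (\<lambda>p q. x * outer a b p q + cnj x * outer b a p q)))"
proof -
  obtain a where a: "a \<noteq> (\<lambda>_. 0)" and ker: "\<And>n. n \<noteq> i \<Longrightarrow> mat_vec (F n) a = (\<lambda>_. 0)"
  proof (cases "\<exists>m. m \<noteq> i \<and> F m \<noteq> (\<lambda>_ _. 0)")
    case False
    then have "F n = (\<lambda>_ _. 0)" if "n \<noteq> i" for n
      using that by blast
    then have "mat_vec (F n) (\<lambda>_. 1) = (\<lambda>_. 0)" if "n \<noteq> i" for n
      using that by (simp add: mat_vec_def)
    then show thesis using that[of "\<lambda>_. 1"] by (auto simp: fun_eq_iff)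
  next
    case True
    then obtain m where m: "m \<noteq> i" "F m \<noteq> (\<lambda>_ _. 0)" by blast
    obtain a where a: "a \<noteq> (\<lambda>_. 0)" "mat_vec (F m) a = (\<lambda>_. 0)"
      using singular_kernel[OF sing[OF m(1)]] by blast
    obtain b where ab: "vdet a b \<noteq> 0" using nonzero_vdet_partner a(1) by blast
    define e where "e = mat_vec (F i) a"
    define f where "f = mat_vec (F i) b"
    define v where "v = mat_vec (F m) b"
    have ef: "vdet e f \<noteq> 0" using vdet_mat_vec[of "F i" a b] nz ab by (simp add: e_def f_def)
    then have e0: "e \<noteq> (\<lambda>_. 0)" by (auto simp: vdet_def)
    have v0: "v \<noteq> (\<lambda>_. 0)"
    proof
      assume "v = (\<lambda>_. 0)"
      then have 1: "F m s False * a False + F m s True * a True = 0" "F m s False * b False + F m s True * b True = 0" for s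
        using a(2) by (auto simp: v_def mat_vec_def fun_eq_iff)
      have 2: "F m s False * vdet a b = b True * (F m s False * a False + F m s True * a True) - a True * (F m s False * b False + F m s True * b True)"
        "F m s True * vdet a b = a False * (F m s False * b False + F m s True * b True) - b False * (F m s False * a False + F m s True * a True)" for s
        by (simp_all add: vdet_def algebra_simps)
      have "F m s False * vdet a b = 0" "F m s True * vdet a b = 0" for s
        unfolding 2 1 by simp_all
      then have "F m s False = 0" "F m s True = 0" for s using ab by simp_all
      then have "F m s t = 0" for s t by (cases t) auto
      then show False using m(2) by (auto simp: fun_eq_iff)
    qed
    \<comment> \<open>Since \<open>F m\<close> kills \<open>a\<close>, orthogonality to
      \<open>F i\<close> puts the image of \<open>F m\<close> on the line of
      \<open>e\<close>.\<close>
    have "vdet e v = 0"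
      using vdet_mat_vec_polar[of "F i" a "F m" b] orth[of i m] m(1) a(2)
      by (simp add: e_def v_def) (simp add: vdet_def)
    then obtain \<sigma> where \<sigma>: "v = (\<lambda>s. \<sigma> * e s)" using vdet_zero_imp_multiple e0 by blast
    have \<sigma>0: "\<sigma> \<noteq> 0" using v0 \<sigma> by auto
    \<comment> \<open>Orthogonality to \<open>F m\<close> confines \<open>mat_vec (F n) a\<close> to
      the line of \<open>e\<close>, say tau e. Orthogonality to \<open>F i\<close>, together with
      the singularity of \<open>F n\<close>, then gives tau^2 vdet e f = 0.\<close>
    have "mat_vec (F n) a = (\<lambda>_. 0)" if n: "n \<noteq> i" for n
    proof (cases "n = m")
      case False
      have "vdet (mat_vec (F n) a) v = 0"
        using vdet_mat_vec_polar[of "F m" a "F n" b] orth[of m n] False a(2)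
        by (simp add: v_def) (simp add: vdet_def)
      moreover have "\<sigma> * vdet e (mat_vec (F n) a) = - vdet (mat_vec (F n) a) v"
        by (simp add: \<sigma> vdet_def algebra_simps)
      ultimately have "\<sigma> * vdet e (mat_vec (F n) a) = 0" by simp
      then obtain \<tau> where \<tau>: "mat_vec (F n) a = (\<lambda>s. \<tau> * e s)"
        using \<sigma>0 vdet_zero_imp_multiple e0 by (metis mult_eq_0_iff)
      have "vdet e (mat_vec (F n) b) + \<tau> * vdet e f = 0"
        using vdet_mat_vec_polar[of "F i" a "F n" b] orth[of i n] n
        by (simp add: e_def[symmetric] f_def[symmetric] \<tau>) (simp add: vdet_def algebra_simps)
      moreover have "\<tau> * vdet e (mat_vec (F n) b) = 0"
        using vdet_mat_vec[of "F n" a b] sing[OF n] unfolding \<tau> by (simp add: vdet_def algebra_simps)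
      ultimately have "\<tau> * (\<tau> * vdet e f) = 0" by algebra
      then show ?thesis using ef \<tau> by simp
    qed (use a in simp)
    then show thesis using that a(1) by blast
  qed
  obtain b where ab: "vdet a b \<noteq> 0" using nonzero_vdet_partner a(1) by blast
  show thesis
  proof (rule that[OF ab])
    fix x
    \<comment> \<open>With \<open>a\<close> in every other kernel, the sandwich on this plane comes
      from \<open>F i\<close> alone.\<close>
    have single: "(\<Sum>n\<in>UNIV. h n) = h i" if "\<And>n. n \<noteq> i \<Longrightarrow> h n = 0" for h :: "'i \<Rightarrow> complex"
      using sum.remove[of UNIV i h] that by simp
    have "sandwich F (\<lambda>p q. x * outer a b p q + cnj x * outer b a p q)
        = (\<lambda>s r. x * outer (mat_vec (F i) a) (mat_vec (F i) b) s r + cnj x * outer (mat_vec (F i) b) (mat_vec (F i) a) s r)"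
      unfolding sandwich_comb sandwich_outer by (intro ext) (simp add: single ker outer_def)
    then show "(cmod x)\<^sup>2 * (cmod (vdet a b))\<^sup>2 * (cmod (det2 (F i)))\<^sup>2
      = - Re (det2 (sandwich F (\<lambda>p q. x * outer a b p q + cnj x * outer b a p q)))"
      by (simp add: det2_hermitian_outer vdet_mat_vec norm_mult power_mult_distrib)
  qed
qed

lemma four_elements:
  fixes i j :: "'i::finite"
  assumes "CARD('i) = 4" "i \<noteq> j"
  obtains k l where "distinct [i, j, k, l]" "UNIV = {i, j, k, l}"
proof -
  have "card (UNIV - {i, j}) = 2" using assms by (simp add: card_Diff_subset)
  then obtain k l where "UNIV - {i, j} = {k, l}" "k \<noteq> l" by (auto simp: card_2_iff)
  then show thesis using that[of k l] assms(2) by auto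
qed

text \<open>A matter of labels: two invertible matrices are taken as \<open>i\<close>,
  \<open>j\<close> in order of size and the other two as \<open>k\<close>, \<open>l\<close>. With a
  single invertible matrix three determinants vanish, and the combination reduces to that of
  \<open>F i\<close>.\<close>

lemma negative_plane:
  fixes F :: "'i::finite \<Rightarrow> mat2"
  assumes card: "CARD('i) = 4"
    and orth: "\<And>i j. i \<noteq> j \<Longrightarrow> polar2 (F i) (F j) = 0"
    and nz: "\<exists>i. det2 (F i) \<noteq> 0"
  obtains i j k l a b where "distinct [i, j, k, l]" "UNIV = {i, j, k, l}" "vdet a b \<noteq> 0"
    "\<And>x. (cmod x)\<^sup>2 * (cmod (vdet a b))\<^sup>2 *
        (cmod (det2 (F i)) - cmod (det2 (F j)) - cmod (det2 (F k)) + cmod (det2 (F l)))\<^sup>2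
      \<le> - Re (det2 (sandwich F (\<lambda>p q. x * outer a b p q + cnj x * outer b a p q)))"
proof -
  obtain i where i: "det2 (F i) \<noteq> 0" using nz by blast
  show thesis
  proof (cases "\<exists>j. j \<noteq> i \<and> det2 (F j) \<noteq> 0")
    case True
    then obtain j where j: "j \<noteq> i" "det2 (F j) \<noteq> 0" by blast
    obtain i' j' where ij: "i' \<noteq> j'" "det2 (F i') \<noteq> 0" "det2 (F j') \<noteq> 0" "cmod (det2 (F j')) \<le> cmod (det2 (F i'))"
      using i j linear[of "cmod (det2 (F j))" "cmod (det2 (F i))"] by metis
    obtain k l where kl: "distinct [i', j', k, l]" "UNIV = {i', j', k, l}" by (rule four_elements[OF card ij(1)])
    obtain k' l' where kl': "distinct [i', j', k', l']" "UNIV = {i', j', k', l'}" "cmod (det2 (F l')) \<le> cmod (det2 (F k'))"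
    proof (cases "cmod (det2 (F l)) \<le> cmod (det2 (F k))")
      case False
      then show thesis using that[of l k] kl by (auto simp: insert_commute)
    qed (use that kl in blast)
    show thesis
      by (rule x_state_frame[OF orth kl'(1,2) ij(2-4) kl'(3)]) (use that kl' in blast)+
  next
    case False
    then have sing: "det2 (F n) = 0" if "n \<noteq> i" for n using that by blast
    obtain j where "j \<noteq> i"
    proof -
      have "card (UNIV :: 'i set) \<noteq> card {i}" using card by simp
      then have "UNIV \<noteq> {i}" by metis
      then show thesis using that by blast
    qed
    then obtain k l where kl: "distinct [i, j, k, l]" "UNIV = {i, j, k, l}" using four_elements[OF card, of i j] by metis
    have "\<exists>a b. vdet a b \<noteq> 0 \<and> (\<forall>x. (cmod x)\<^sup>2 * (cmod (vdet a b))\<^sup>2 * (cmod (det2 (F i)))\<^sup>2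
        = - Re (det2 (sandwich F (\<lambda>p q. x * outer a b p q + cnj x * outer b a p q))))"
      by (rule single_invertible_frame[where F = F and i = i, OF orth i sing]) blast+
    then obtain a b where ab: "vdet a b \<noteq> 0"
      "\<And>x. (cmod x)\<^sup>2 * (cmod (vdet a b))\<^sup>2 * (cmod (det2 (F i)))\<^sup>2
        = - Re (det2 (sandwich F (\<lambda>p q. x * outer a b p q + cnj x * outer b a p q)))"
      by blast
    have "det2 (F j) = 0" "det2 (F k) = 0" "det2 (F l) = 0" using sing kl(1) by auto
    then show thesis
      by (intro that[OF kl ab(1)]) (simp flip: ab(2))
  qed
qed

section \<open>Mixing a family until all determinants are equal\<close>

lemma phase_square:
  fixes z :: complex
  obtains u where "cmod u = 1" "u\<^sup>2 * z = of_real (cmod z)"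
proof (cases "z = 0")
  case False
  have "cmod (csqrt (cnj (sgn z))) = 1"
    using False by (simp add: norm_sgn)
  moreover have "(csqrt (cnj (sgn z)))\<^sup>2 * z = of_real (cmod z)"
  proof -
    have "cnj (sgn z) * z = z * cnj z / of_real (cmod z)" by (simp add: sgn_eq)
    also have "\<dots> = of_real (cmod z)"
      using False unfolding complex_norm_square[symmetric] by (simp add: power2_eq_square)
    finally show ?thesis by simp
  qed
  ultimately show thesis using that by blast
qed (use that[of 1] in simp)

text \<open>The phases \<open>\<eta>\<close> turn the determinants into d_i, -d_j, -d_k, d_l, the
  extra factor i at \<open>j\<close> and \<open>k\<close> accounting for the minus signs. Half the 4
  by 4 Hadamard matrix is unitary; its signs disappear on squaring and orthogonality removes the
  mixed terms. So all four new determinants equal a quarter of the signed sum, and their moduli add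
  up to its modulus.\<close>

lemma hadamard_mixing:
  fixes F :: "'i::finite \<Rightarrow> mat2"
  assumes dist: "distinct [i, j, k, l]" and univ: "UNIV = {i, j, k, l}"
    and orth: "\<And>i j. i \<noteq> j \<Longrightarrow> polar2 (F i) (F j) = 0"
  obtains Y where "same_gram Y F"
    "(\<Sum>n\<in>UNIV. cmod (det2 (Y n))) = \<bar>cmod (det2 (F i)) - cmod (det2 (F j)) - cmod (det2 (F k)) + cmod (det2 (F l))\<bar>"
proof -
  have "\<exists>u. cmod u = 1 \<and> u\<^sup>2 * det2 (F n) = of_real (cmod (det2 (F n)))" for n
    by (rule phase_square[of "det2 (F n)"]) blast
  then obtain \<theta> where \<theta>: "\<And>n. cmod (\<theta> n) = 1" "\<And>n. (\<theta> n)\<^sup>2 * det2 (F n) = of_real (cmod (det2 (F n)))" by metis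
  define \<eta> where "\<eta> n = (if n = i \<or> n = l then \<theta> n else \<i> * \<theta> n)" for n
  have \<eta>: "cmod (\<eta> n) = 1" for n by (simp add: \<eta>_def \<theta> norm_mult)
  have \<eta>\<eta>: "\<eta> n * cnj (\<eta> n) = 1" for n unfolding complex_norm_square[symmetric] \<eta> by simp
  have \<eta>2: "(\<eta> n)\<^sup>2 * det2 (F n) = (if n = i \<or> n = l then 1 else -1) * of_real (cmod (det2 (F n)))" for n
    unfolding \<theta>(2)[symmetric] by (simp add: \<eta>_def power_mult_distrib)
  define Y where "Y n = (\<lambda>s t. (\<eta> i * F i s t + (if n = i \<or> n = j then 1 else -1) * (\<eta> j * F j s t)
      + (if n = i \<or> n = k then 1 else -1) * (\<eta> k * F k s t) + (if n = i \<or> n = l then 1 else -1) * (\<eta> l * F l s t)) / 2)" for n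
  have sum4: "(\<Sum>n\<in>UNIV. h n) = h i + h j + h k + h l" for h :: "'i \<Rightarrow> 'a::comm_monoid_add"
    unfolding univ using dist by (simp add: add_ac)
  have ne: "i \<noteq> j" "i \<noteq> k" "i \<noteq> l" "j \<noteq> k" "j \<noteq> l" "k \<noteq> l" using dist by auto
  have "same_gram Y F"
    unfolding same_gram_def
  proof (intro allI)
    fix a b a' b'
    have "(\<Sum>n\<in>UNIV. Y n a b * cnj (Y n a' b'))
      = (\<eta> i * cnj (\<eta> i)) * (F i a b * cnj (F i a' b')) + (\<eta> j * cnj (\<eta> j)) * (F j a b * cnj (F j a' b'))
      + (\<eta> k * cnj (\<eta> k)) * (F k a b * cnj (F k a' b')) + (\<eta> l * cnj (\<eta> l)) * (F l a b * cnj (F l a' b'))"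
      unfolding sum4 Y_def by (simp add: ne ne[symmetric]) (simp add: field_simps)
    then show "(\<Sum>n\<in>UNIV. Y n a b * cnj (Y n a' b')) = (\<Sum>n\<in>UNIV. F n a b * cnj (F n a' b'))"
      unfolding \<eta>\<eta> sum4 by simp
  qed
  moreover
  define D where "D = cmod (det2 (F i)) - cmod (det2 (F j)) - cmod (det2 (F k)) + cmod (det2 (F l))"
  have comb: "det2 (\<lambda>s t. (x1 * X1 s t + c2 * (x2 * X2 s t) + c3 * (x3 * X3 s t) + c4 * (x4 * X4 s t)) / 2)
      = (x1\<^sup>2 * det2 X1 + c2\<^sup>2 * (x2\<^sup>2 * det2 X2) + c3\<^sup>2 * (x3\<^sup>2 * det2 X3) + c4\<^sup>2 * (x4\<^sup>2 * det2 X4)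
        + x1 * c2 * x2 * polar2 X1 X2 + x1 * c3 * x3 * polar2 X1 X3 + x1 * c4 * x4 * polar2 X1 X4
        + c2 * x2 * c3 * x3 * polar2 X2 X3 + c2 * x2 * c4 * x4 * polar2 X2 X4 + c3 * x3 * c4 * x4 * polar2 X3 X4) / 4"
    for x1 x2 x3 x4 c2 c3 c4 and X1 X2 X3 X4 :: mat2
    by (simp add: det2_def polar2_def field_simps power2_eq_square)
  have "det2 (Y n) = of_real (D / 4)" for n
  proof -
    have "polar2 (F i) (F j) = 0" "polar2 (F i) (F k) = 0" "polar2 (F i) (F l) = 0"
      "polar2 (F j) (F k) = 0" "polar2 (F j) (F l) = 0" "polar2 (F k) (F l) = 0"
      using orth dist by auto
    moreover have "(if c then 1 else - 1 :: complex)\<^sup>2 = 1" for c by simp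
    ultimately show ?thesis unfolding Y_def comb by (simp only: \<eta>2) (simp add: D_def ne ne[symmetric])
  qed
  then have "(\<Sum>n\<in>UNIV. cmod (det2 (Y n))) = \<bar>D\<bar>"
    by (simp only: sum4 norm_of_real)
  ultimately show thesis using that unfolding D_def by blast
qed

section \<open>A measurement on the second qubit\<close>

definition psd2 :: "mat2 \<Rightarrow> bool" where
  "psd2 A \<longleftrightarrow> (\<forall>s t. cnj (A s t) = A t s) \<and> 0 \<le> Re (A False False) \<and> 0 \<le> Re (A True True) \<and> 0 \<le> Re (det2 A)"

lemma Re_det2_hermitian:
  assumes "\<And>s t. cnj (A s t) = A t s"
  shows "Re (det2 A) = Re (A False False) * Re (A True True) - (cmod (A False True))\<^sup>2"
proof -
  have "Im (A s s) = 0" for s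
    using assms[of s s] by (simp add: complex_eq_iff)
  then show ?thesis
    using assms[of False True, symmetric]
    by (simp add: det2_def cmod_power2) (simp add: power2_eq_square)
qed

text \<open>The second claim is Minkowski's determinant inequality in dimension two. With diagonal
  p, q and off-diagonal modulus h one has p q = h^2 + alpha^2; Cauchy-Schwarz and then the
  inequality of the means bound the mixed terms.\<close>

lemma psd2_add:
  assumes A: "psd2 A" and B: "psd2 B"
  shows "psd2 (\<lambda>s t. A s t + B s t)"
    and "sqrt (Re (det2 A)) + sqrt (Re (det2 B)) \<le> sqrt (Re (det2 (\<lambda>s t. A s t + B s t)))"
proof -
  have hA: "\<And>s t. cnj (A s t) = A t s" and hB: "\<And>s t. cnj (B s t) = B t s"
    using assms by (auto simp: psd2_def)
  have hS: "cnj (A s t + B s t) = A t s + B t s" for s t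
    by (simp add: hA hB)
  define p q h where "p = Re (A False False)" "q = Re (A True True)" "h = cmod (A False True)"
  define p' q' h' where "p' = Re (B False False)" "q' = Re (B True True)" "h' = cmod (B False True)"
  note defs = p_q_h_def p'_q'_h'_def
  define \<alpha> where "\<alpha> = sqrt (Re (det2 A))"
  define \<beta> where "\<beta> = sqrt (Re (det2 B))"
  have pos: "0 \<le> p" "0 \<le> q" "0 \<le> p'" "0 \<le> q'" "0 \<le> h" "0 \<le> h'" "0 \<le> \<alpha>" "0 \<le> \<beta>"
    using assms by (auto simp: psd2_def defs \<alpha>_def \<beta>_def)
  have dA: "p * q = h\<^sup>2 + \<alpha>\<^sup>2" and dB: "p' * q' = h'\<^sup>2 + \<beta>\<^sup>2"
    using assms Re_det2_hermitian[OF hA] Re_det2_hermitian[OF hB]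
    by (auto simp: psd2_def defs \<alpha>_def \<beta>_def)
  have "(h * h' + \<alpha> * \<beta>)\<^sup>2 \<le> (h\<^sup>2 + \<alpha>\<^sup>2) * (h'\<^sup>2 + \<beta>\<^sup>2)"
    using zero_le_power2[of "h * \<beta> - h' * \<alpha>"] by (simp add: power2_eq_square algebra_simps)
  also have "\<dots> = (p * q') * (p' * q)" by (simp flip: dA dB)
  also have "4 * \<dots> \<le> (p * q' + p' * q)\<^sup>2"
    using zero_le_power2[of "p * q' - p' * q"] by (simp add: power2_eq_square algebra_simps)
  finally have "(2 * (h * h' + \<alpha> * \<beta>))\<^sup>2 \<le> (p * q' + p' * q)\<^sup>2"
    by (simp only: power_mult_distrib) simp
  then have cross: "2 * (h * h' + \<alpha> * \<beta>) \<le> p * q' + p' * q"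
    by (rule power2_le_imp_le) (use pos in simp)
  have "cmod (A False True + B False True) \<le> h + h'"
    unfolding defs by (rule norm_triangle_ineq)
  then have "(cmod (A False True + B False True))\<^sup>2 \<le> (h + h')\<^sup>2"
    by (intro power_mono) auto
  then have "(\<alpha> + \<beta>)\<^sup>2 \<le> (p + p') * (q + q') - (cmod (A False True + B False True))\<^sup>2"
    using cross dA dB by (simp add: power2_eq_square algebra_simps)
  also have "\<dots> = Re (det2 (\<lambda>s t. A s t + B s t))"
    using Re_det2_hermitian[of "\<lambda>s t. A s t + B s t"] hS by (simp add: defs)
  finally have le: "(\<alpha> + \<beta>)\<^sup>2 \<le> Re (det2 (\<lambda>s t. A s t + B s t))" .
  then show "sqrt (Re (det2 A)) + sqrt (Re (det2 B)) \<le> sqrt (Re (det2 (\<lambda>s t. A s t + B s t)))"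
    unfolding \<alpha>_def[symmetric] \<beta>_def[symmetric] by (rule real_le_rsqrt)
  have "0 \<le> Re (det2 (\<lambda>s t. A s t + B s t))" using le by (meson order_trans zero_le_power2)
  then show "psd2 (\<lambda>s t. A s t + B s t)"
    using hS pos by (simp add: psd2_def defs)
qed

lemma psd2_sum:
  assumes "finite I" "\<And>i. i \<in> I \<Longrightarrow> psd2 (A i)"
  shows "psd2 (\<lambda>s t. \<Sum>i\<in>I. A i s t) \<and>
    (\<Sum>i\<in>I. sqrt (Re (det2 (A i)))) \<le> sqrt (Re (det2 (\<lambda>s t. \<Sum>i\<in>I. A i s t)))"
  using assms
proof (induction I rule: finite_induct)
  case empty
  show ?case by (simp add: psd2_def det2_def)
next
  case (insert i I)
  then show ?case
    using psd2_add[of "A i" "\<lambda>s t. \<Sum>i\<in>I. A i s t"] by fastforce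
qed

lemma psd2_outer: "psd2 (outer u u)"
  by (simp add: psd2_def outer_def det2_def mult.commute)

lemma psd2_mult_adjoint:
  "psd2 (\<lambda>s t. \<Sum>p\<in>UNIV. X s p * cnj (X t p))"
  "sqrt (Re (det2 (\<lambda>s t. \<Sum>p\<in>UNIV. X s p * cnj (X t p)))) = cmod (det2 X)"
proof -
  show "psd2 (\<lambda>s t. \<Sum>p\<in>UNIV. X s p * cnj (X t p))"
    using psd2_sum[of UNIV "\<lambda>p. outer (\<lambda>s. X s p) (\<lambda>s. X s p)"] psd2_outer by (simp add: outer_def)
  have "det2 (\<lambda>s t. \<Sum>p\<in>UNIV. X s p * cnj (X t p)) = det2 X * cnj (det2 X)"
    by (simp add: det2_def UNIV_bool algebra_simps)
  then show "sqrt (Re (det2 (\<lambda>s t. \<Sum>p\<in>UNIV. X s p * cnj (X t p)))) = cmod (det2 X)"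
    by (simp flip: complex_norm_square)
qed

lemma psd2_sandwich_outer: "psd2 (sandwich F (outer u u))"
  using psd2_sum[of UNIV "\<lambda>i. outer (mat_vec (F i) u) (mat_vec (F i) u)"] psd2_outer
  unfolding sandwich_outer by (simp add: outer_def)

definition id2 :: mat2 where "id2 = (\<lambda>p q. if p = q then 1 else 0)"

text \<open>The sandwich of the identity is the sum of all F_i F_i^*, so this is superadditivity of
  the root of the determinant. In terms of states: no ensemble of AB has a larger average
  concurrence than the pure state has across A|BC.\<close>

lemma sum_det2_le_sandwich_id2:
  "(\<Sum>i\<in>UNIV. cmod (det2 (F i))) \<le> sqrt (Re (det2 (sandwich F id2)))"
proof -
  have "sandwich F id2 = (\<lambda>s t. \<Sum>i\<in>UNIV. \<Sum>p\<in>UNIV. F i s p * cnj (F i t p))"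
    by (intro ext) (simp add: sandwich_def id2_def UNIV_bool sum.distrib)
  then show ?thesis
    using psd2_sum[of UNIV "\<lambda>i s t. \<Sum>p\<in>UNIV. F i s p * cnj (F i t p)"] psd2_mult_adjoint by simp
qed

text \<open>As \<open>N\<close> is a traceless Hermitian involution, (1 + N)/2 and (1 - N)/2 are
  projections of rank one. \<open>u\<close> is the normalised first column of the former,
  \<open>v\<close> the normalised second column of the latter; \<open>0 \<le> r\<close> keeps the
  norming factor away from zero.\<close>

lemma traceless_unitary_eigenbasis:
  fixes r :: real and w :: complex
  assumes "r\<^sup>2 + (cmod w)\<^sup>2 = 1" "0 \<le> r"
  defines "N \<equiv> \<lambda>p q. if p = q then (if p then - of_real r else of_real r) else if q then w else cnj w"
  obtains u v where "\<And>p q. outer u u p q = (id2 p q + N p q) / 2" "\<And>p q. outer v v p q = (id2 p q - N p q) / 2"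
proof -
  define m where "m = sqrt (2 * (1 + r))"
  have m: "m > 0" "m\<^sup>2 = 2 * (1 + r)" using assms(2) by (simp_all add: m_def)
  have mm: "complex_of_real m * complex_of_real m = 2 * (1 + of_real r)"
    using m(2) by (metis of_real_1 of_real_add of_real_mult of_real_numeral power2_eq_square)
  have m0: "complex_of_real m \<noteq> 0" using m(1) by simp
  have r0: "1 + complex_of_real r \<noteq> 0"
    using assms(2) by (metis add_nonneg_pos add.commute less_numeral_extra(1,3) of_real_1 of_real_add of_real_eq_0_iff)
  have ww: "w * cnj w = (1 - of_real r) * (1 + of_real r)"
  proof -
    have "(cmod w)\<^sup>2 = (1 - r) * (1 + r)" using assms(1) by (simp add: power2_eq_square algebra_simps)
    then show ?thesis unfolding complex_norm_square[symmetric] by simp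
  qed
  define u where "u = (\<lambda>p. (if p then cnj w else 1 + of_real r) / of_real m)"
  define v where "v = (\<lambda>p. (if p then 1 + of_real r else - w) / of_real m)"
  have eqI: "x / of_real m * cnj (y / of_real m) = z / 2" if "x * cnj y = z * (1 + of_real r)" for x y z
  proof -
    have "x / of_real m * cnj (y / of_real m) = x * cnj y / (complex_of_real m * complex_of_real m)" by simp
    also have "\<dots> = z * (1 + of_real r) / (2 * (1 + of_real r))" by (simp only: that mm)
    also have "\<dots> = z / 2" by (rule nonzero_mult_divide_mult_cancel_right[OF r0])
    finally show ?thesis .
  qed
  have "outer u u p q = (id2 p q + N p q) / 2" for p q
    unfolding outer_def u_def
    by (rule eqI) (use ww in \<open>auto simp: N_def id2_def algebra_simps\<close>)
  moreover have "outer v v p q = (id2 p q - N p q) / 2" for p q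
    unfolding outer_def v_def
    by (rule eqI) (use ww in \<open>auto simp: N_def id2_def algebra_simps\<close>)
  ultimately show thesis using that by blast
qed

section \<open>Choice of the measurement direction\<close>

lemma det2_add: "det2 (\<lambda>p q. X p q + Y p q) = det2 X + polar2 X Y + det2 Y"
  by (simp add: det2_def polar2_def algebra_simps)

lemma det2_scale: "det2 (\<lambda>p q. c * X p q) = c\<^sup>2 * det2 X"
  by (simp add: det2_def power2_eq_square algebra_simps)

lemma polar2_adjoint: "polar2 (\<lambda>s t. cnj (A t s)) (\<lambda>s t. cnj (B t s)) = cnj (polar2 A B)"
  by (simp add: polar2_def algebra_simps)

lemma id2_adjoint: "(\<lambda>p q. cnj (id2 q p)) = id2"
  by (auto simp: id2_def fun_eq_iff)

lemma sandwich_id2_adjoint: "(\<lambda>s t. cnj (sandwich F id2 t s)) = sandwich F id2"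
  by (intro ext) (metis sandwich_adjoint id2_adjoint)

text \<open>Take Z in the plane and make it traceless as N1 = Z - tau 1. Orthogonality of E(N1) to
  E(1) is one real linear equation for \<open>x\<close>, hence solvable with \<open>x\<close>
  nonzero. It implies det E(N1) = det E(Z) - tau^2 det E(1), while det N1 = det Z - tau^2; the
  hypothesis c^2 <= det E(1) therefore carries the bound from Z over to N1. Scaling to determinant
  -1 gives \<open>N\<close>.\<close>

lemma negative_direction:
  fixes F :: "'i::finite \<Rightarrow> mat2"
  assumes ab: "vdet a b \<noteq> 0"
    and plane: "\<And>x. (cmod x)\<^sup>2 * (cmod (vdet a b))\<^sup>2 * c\<^sup>2
      \<le> - Re (det2 (sandwich F (\<lambda>p q. x * outer a b p q + cnj x * outer b a p q)))"
    and c: "c\<^sup>2 \<le> Re (det2 (sandwich F id2))"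
  obtains r :: real and w :: complex and N where "r\<^sup>2 + (cmod w)\<^sup>2 = 1" "0 \<le> r"
    "N = (\<lambda>p q. if p = q then (if p then - of_real r else of_real r) else if q then w else cnj w)"
    "polar2 (sandwich F id2) (sandwich F N) = 0"
    "Re (det2 (sandwich F N)) \<le> - c\<^sup>2"
proof -
  let ?I = "sandwich F id2"
  define D where "D = Re (det2 ?I)"
  have detI: "det2 ?I = of_real D"
  proof -
    have "cnj (det2 ?I) = det2 ?I"
      using polar2_adjoint[of ?I ?I] by (simp add: sandwich_id2_adjoint polar2_self)
    then show ?thesis by (simp add: D_def complex_eq_iff)
  qed
  \<comment> \<open>\<open>\<tau>0\<close> is half the trace of a b^*, and \<open>\<kappa>\<close>
    is the pairing with E(1) after the trace part has been removed. The next choice of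
    \<open>x\<close> makes the real part of \<open>x * \<kappa>\<close> vanish.\<close>
  define \<tau>0 where "\<tau>0 = (outer a b False False + outer a b True True) / 2"
  define \<kappa> where "\<kappa> = polar2 ?I (sandwich F (outer a b)) - \<tau>0 * (2 * D)"
  define x where "x = (if \<kappa> = 0 then 1 else \<i> * cnj \<kappa>)"
  have x0: "x \<noteq> 0" by (simp add: x_def)
  have "x * \<kappa> + cnj x * cnj \<kappa> = 0" by (simp add: x_def algebra_simps)
  define Z where "Z = (\<lambda>p q. x * outer a b p q + cnj x * outer b a p q)"
  define \<tau> where "\<tau> = Re (x * \<tau>0) * 2"
  have tau: "of_real \<tau> = x * \<tau>0 + cnj x * cnj \<tau>0"
    by (simp add: \<tau>_def complex_eq_iff)
  have outer_adj: "outer b a = (\<lambda>p q. cnj (outer a b q p))"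
    by (simp add: outer_def mult.commute)
  have sba: "sandwich F (outer b a) = (\<lambda>s t. cnj (sandwich F (outer a b) t s))"
    unfolding outer_adj by (intro ext sandwich_adjoint)
  have "polar2 ?I (sandwich F (outer b a)) = cnj (polar2 ?I (sandwich F (outer a b)))"
    using polar2_adjoint[of ?I "sandwich F (outer a b)"] by (simp only: sandwich_id2_adjoint sba)
  then have "polar2 ?I (sandwich F Z) = x * polar2 ?I (sandwich F (outer a b)) + cnj x * cnj (polar2 ?I (sandwich F (outer a b)))"
    by (simp only: Z_def sandwich_comb polar2_comb_right)
  also have "\<dots> = x * \<kappa> + cnj x * cnj \<kappa> + \<tau> * (2 * D)"
    by (simp add: \<kappa>_def tau algebra_simps)
  also have "\<dots> = of_real (\<tau> * (2 * D))" using \<open>x * \<kappa> + cnj x * cnj \<kappa> = 0\<close> by simp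
  finally have polZ: "polar2 ?I (sandwich F Z) = of_real (2 * D * \<tau>)" by (simp add: mult_ac)
  define N1 where "N1 = (\<lambda>p q. 1 * Z p q + (- of_real \<tau>) * id2 p q)"
  have sN1: "sandwich F N1 = (\<lambda>s t. sandwich F Z s t + (- of_real \<tau>) * ?I s t)"
    unfolding N1_def sandwich_comb by simp
  have pol: "polar2 ?I (sandwich F N1) = 0"
  proof -
    have "polar2 ?I (sandwich F N1) = polar2 ?I (sandwich F Z) - \<tau> * polar2 ?I ?I"
      using polar2_comb_right[of ?I 1 "sandwich F Z" "- of_real \<tau>" ?I] by (simp add: sN1)
    then show ?thesis by (simp add: polZ polar2_self detI)
  qed
  define \<nu> where "\<nu> = (cmod x)\<^sup>2 * (cmod (vdet a b))\<^sup>2 + \<tau>\<^sup>2"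
  have \<nu>: "\<nu> > 0" using x0 ab by (simp add: \<nu>_def add_pos_nonneg)
  have detN1: "det2 (sandwich F N1) = det2 (sandwich F Z) - of_real (\<tau>\<^sup>2 * D)"
  proof -
    have "det2 (sandwich F N1) = det2 (sandwich F Z) + polar2 (sandwich F Z) (\<lambda>s t. (- of_real \<tau>) * ?I s t) + \<tau>\<^sup>2 * det2 ?I"
      unfolding sN1 det2_add det2_scale by simp
    also have "polar2 (sandwich F Z) (\<lambda>s t. (- of_real \<tau>) * ?I s t) = - \<tau> * polar2 ?I (sandwich F Z)"
      by (simp add: polar2_def algebra_simps)
    finally show ?thesis by (simp add: polZ detI power2_eq_square algebra_simps)
  qed
  have "(cmod x)\<^sup>2 * (cmod (vdet a b))\<^sup>2 * c\<^sup>2 + \<tau>\<^sup>2 * c\<^sup>2 \<le> - Re (det2 (sandwich F Z)) + \<tau>\<^sup>2 * D"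
    using plane[of x] c unfolding Z_def D_def by (intro add_mono mult_left_mono) auto
  then have neg: "Re (det2 (sandwich F N1)) \<le> - \<nu> * c\<^sup>2"
    by (simp add: detN1 \<nu>_def algebra_simps)
  have N1_adj: "cnj (N1 p q) = N1 q p" for p q
    by (auto simp: N1_def Z_def outer_def id2_def algebra_simps)
  have N1_tr: "N1 False False + N1 True True = 0"
    by (simp add: N1_def Z_def id2_def tau) (simp add: \<tau>0_def outer_def field_simps)
  have detN: "det2 N1 = - of_real \<nu>"
  proof -
    have "det2 N1 = det2 Z - of_real \<tau> * (Z False False + Z True True) + of_real (\<tau>\<^sup>2)"
      by (simp add: N1_def det2_def id2_def power2_eq_square algebra_simps)
    also have "Z False False + Z True True = 2 * of_real \<tau>"
      using N1_tr by (simp add: N1_def id2_def algebra_simps)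
    also have "det2 Z = - of_real ((cmod x)\<^sup>2 * (cmod (vdet a b))\<^sup>2)"
      unfolding Z_def by (rule det2_hermitian_outer)
    finally show ?thesis by (simp add: \<nu>_def power2_eq_square)
  qed
  define r0 where "r0 = Re (N1 False False)"
  \<comment> \<open>The sign gives \<open>0 \<le> r\<close>: passing from N to -N merely exchanges
    the two projections.\<close>
  define s where "s = (if r0 < 0 then - 1 else 1) / sqrt \<nu>"
  have s2: "s\<^sup>2 = 1 / \<nu>" using \<nu> by (simp add: s_def power_divide)
  define r where "r = s * r0"
  define w where "w = of_real s * N1 False True"
  define N where "N = (\<lambda>p q. of_real s * N1 p q)"
  have N00: "N1 False False = of_real r0"
    using N1_adj[of False False] by (simp add: r0_def complex_eq_iff)
  have \<nu>eq: "\<nu> = r0\<^sup>2 + (cmod (N1 False True))\<^sup>2"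
  proof -
    have "N1 True True = - of_real r0" using N1_tr N00 by (simp add: add_eq_0_iff)
    then have "of_real \<nu> = of_real (r0\<^sup>2) + N1 False True * cnj (N1 False True)"
      using detN N1_adj[of False True] by (simp add: det2_def N00 power2_eq_square algebra_simps)
    also have "\<dots> = of_real (r0\<^sup>2 + (cmod (N1 False True))\<^sup>2)"
      by (simp only: complex_norm_square of_real_add)
    finally show ?thesis using of_real_eq_iff by blast
  qed
  show thesis
  proof (rule that)
    have "r\<^sup>2 + (cmod w)\<^sup>2 = s\<^sup>2 * \<nu>"
      by (simp add: \<nu>eq r_def w_def norm_mult power_mult_distrib algebra_simps)
    then show "r\<^sup>2 + (cmod w)\<^sup>2 = 1" using \<nu> s2 by simp
    show "0 \<le> r" using \<nu> by (simp add: r_def s_def divide_nonpos_pos)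
    show "N = (\<lambda>p q. if p = q then (if p then - of_real r else of_real r) else if q then w else cnj w)"
    proof (intro ext)
      fix p q
      have "N1 True True = - of_real r0" "N1 True False = cnj (N1 False True)"
        using N1_tr N00 N1_adj by (simp_all add: add_eq_0_iff)
      then show "N p q = (if p = q then (if p then - of_real r else of_real r) else if q then w else cnj w)"
        by (cases p; cases q) (simp_all add: N_def r_def w_def N00)
    qed
    have sN: "sandwich F N = (\<lambda>p q. of_real s * sandwich F N1 p q)"
      using sandwich_comb[of F "of_real s" N1 0 N1] by (simp add: N_def)
    show "polar2 ?I (sandwich F N) = 0"
      using polar2_comb_right[of ?I "of_real s" "sandwich F N1" 0 "sandwich F N1"] pol by (simp add: sN)
    have "Re (det2 (sandwich F N)) = s\<^sup>2 * Re (det2 (sandwich F N1))"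
      unfolding sN det2_scale by (simp flip: of_real_power)
    also have "\<dots> \<le> s\<^sup>2 * (- \<nu> * c\<^sup>2)" using neg by (intro mult_left_mono) auto
    also have "\<dots> = - c\<^sup>2" using s2 \<nu> by simp
    finally show "Re (det2 (sandwich F N)) \<le> - c\<^sup>2" .
  qed
qed

text \<open>For \<open>G\<close> listing the amplitudes of rho_AB, four times this inequality is
  monogamy for a pure state of ABC: \<open>Y\<close> is the ensemble of AB, the measurement
  \<open>u\<close>, \<open>v\<close> of B gives the ensemble of AC, and the right side belongs to
  A|BC.\<close>

lemma two_qubit_tradeoff:
  fixes G :: "'i::finite \<Rightarrow> mat2"
  assumes card: "CARD('i) = 4"
  obtains Y u v where "same_gram Y G"
    "\<And>p q. outer u u p q + outer v v p q = id2 p q"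
    "(\<Sum>i\<in>UNIV. cmod (det2 (Y i)))\<^sup>2
      + (sqrt (Re (det2 (sandwich G (outer u u)))) + sqrt (Re (det2 (sandwich G (outer v v)))))\<^sup>2
      \<le> Re (det2 (sandwich G id2))"
proof -
  have "\<exists>F. same_gram F G \<and> (\<forall>i j. i \<noteq> j \<longrightarrow> polar2 (F i) (F j) = 0)"
    by (rule takagi[of G]) blast
  then obtain F where F: "same_gram F G" and orth: "\<And>i j. i \<noteq> j \<Longrightarrow> polar2 (F i) (F j) = 0"
    by blast
  note FG = sandwich_same_gram[OF F, symmetric]
  show thesis
  proof (cases "\<exists>i. det2 (F i) \<noteq> 0")
    \<comment> \<open>Here \<open>F\<close> itself is an ensemble of AB of concurrence zero, and
      superadditivity allows any measurement basis.\<close>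
    case False
    let ?u = "\<lambda>s. if s then 0 else 1" and ?v = "\<lambda>s. if s then 1 else 0"
    let ?A = "sandwich F (outer ?u ?u)" and ?B = "sandwich F (outer ?v ?v)"
    have id: "outer ?u ?u p q + outer ?v ?v p q = id2 p q" for p q
      by (auto simp: outer_def id2_def)
    have "sandwich F id2 = (\<lambda>s t. ?A s t + ?B s t)"
      using sandwich_comb[of F 1 "outer ?u ?u" 1 "outer ?v ?v"] by (simp add: id)
    then have le: "sqrt (Re (det2 ?A)) + sqrt (Re (det2 ?B)) \<le> sqrt (Re (det2 (sandwich F id2)))"
      and psd: "psd2 (sandwich F id2)"
      using psd2_add[OF psd2_sandwich_outer psd2_sandwich_outer, of F ?u F ?v] by simp_all
    have "0 \<le> sqrt (Re (det2 ?A)) + sqrt (Re (det2 ?B))"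
      using psd2_sandwich_outer[of F] by (simp add: psd2_def)
    then have "(sqrt (Re (det2 ?A)) + sqrt (Re (det2 ?B)))\<^sup>2 \<le> (sqrt (Re (det2 (sandwich F id2))))\<^sup>2"
      using le by (intro power_mono) auto
    then show thesis
      using that[of F ?u ?v] F id psd False unfolding FG by (simp add: psd2_def)
  next
    case True
    have "\<exists>i j k l a b. distinct [i, j, k, l] \<and> UNIV = {i, j, k, l} \<and> vdet a b \<noteq> 0 \<and>
      (\<forall>x. (cmod x)\<^sup>2 * (cmod (vdet a b))\<^sup>2 *
        (cmod (det2 (F i)) - cmod (det2 (F j)) - cmod (det2 (F k)) + cmod (det2 (F l)))\<^sup>2
        \<le> - Re (det2 (sandwich F (\<lambda>p q. x * outer a b p q + cnj x * outer b a p q))))"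
      by (rule negative_plane[where F = F, OF card orth True]) blast+
    then obtain i j k l a b where ijkl: "distinct [i, j, k, l]" "UNIV = {i, j, k, l}" and ab: "vdet a b \<noteq> 0"
      and plane: "\<And>x. (cmod x)\<^sup>2 * (cmod (vdet a b))\<^sup>2 *
        (cmod (det2 (F i)) - cmod (det2 (F j)) - cmod (det2 (F k)) + cmod (det2 (F l)))\<^sup>2
        \<le> - Re (det2 (sandwich F (\<lambda>p q. x * outer a b p q + cnj x * outer b a p q)))"
      by blast
    define c where "c = \<bar>cmod (det2 (F i)) - cmod (det2 (F j)) - cmod (det2 (F k)) + cmod (det2 (F l))\<bar>"
    obtain Y where Y: "same_gram Y F" "(\<Sum>n\<in>UNIV. cmod (det2 (Y n))) = c"
      unfolding c_def by (rule hadamard_mixing[OF ijkl orth])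
    have plane': "(cmod x)\<^sup>2 * (cmod (vdet a b))\<^sup>2 * c\<^sup>2
      \<le> - Re (det2 (sandwich F (\<lambda>p q. x * outer a b p q + cnj x * outer b a p q)))" for x
      using plane[of x] by (simp add: c_def)
    have c: "c\<^sup>2 \<le> Re (det2 (sandwich F id2))"
    proof -
      have "c \<le> sqrt (Re (det2 (sandwich F id2)))"
        using sum_det2_le_sandwich_id2[of Y] Y by (simp add: sandwich_same_gram[OF Y(1)])
      moreover have "0 \<le> c" by (simp add: c_def)
      ultimately show ?thesis
        by (metis abs_of_nonneg order_trans real_sqrt_abs real_sqrt_le_iff)
    qed
    obtain r :: real and w :: complex and N where N: "r\<^sup>2 + (cmod w)\<^sup>2 = 1" "0 \<le> r"
      "N = (\<lambda>p q. if p = q then (if p then - of_real r else of_real r) else if q then w else cnj w)"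
      "polar2 (sandwich F id2) (sandwich F N) = 0" "Re (det2 (sandwich F N)) \<le> - c\<^sup>2"
      by (rule negative_direction[OF ab plane' c])
    have "\<exists>u v. (\<forall>p q. outer u u p q = (id2 p q + N p q) / 2) \<and> (\<forall>p q. outer v v p q = (id2 p q - N p q) / 2)"
      unfolding N(3) by (rule traceless_unitary_eigenbasis[OF N(1,2)]) blast
    then obtain u v where uv: "\<And>p q. outer u u p q = (id2 p q + N p q) / 2" "\<And>p q. outer v v p q = (id2 p q - N p q) / 2"
      by blast
    have ou: "outer u u = (\<lambda>p q. (1/2) * id2 p q + (1/2) * N p q)"
      and ov: "outer v v = (\<lambda>p q. (1/2) * id2 p q + (- 1/2) * N p q)"
      by (auto simp: fun_eq_iff uv field_simps)
    \<comment> \<open>The term linear in \<open>\<epsilon>\<close> is the vanishing polar form, so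
      both outcomes have the same determinant.\<close>
    have half: "Re (det2 (sandwich F (\<lambda>p q. (1/2) * id2 p q + \<epsilon> * N p q)))
        = (Re (det2 (sandwich F id2)) + Re (det2 (sandwich F N))) / 4" if "\<epsilon>\<^sup>2 = 1/4" for \<epsilon>
    proof -
      have "det2 (\<lambda>s t. (1/2) * sandwich F id2 s t + \<epsilon> * sandwich F N s t)
        = (1/4) * det2 (sandwich F id2) + (1/2) * \<epsilon> * polar2 (sandwich F id2) (sandwich F N) + \<epsilon>\<^sup>2 * det2 (sandwich F N)"
        by (simp add: det2_def polar2_def power2_eq_square algebra_simps)
      then show ?thesis unfolding sandwich_comb that N(4) by simp
    qed
    define P where "P = Re (det2 (sandwich F id2)) + Re (det2 (sandwich F N))"
    have du: "Re (det2 (sandwich F (outer u u))) = P / 4" and dv: "Re (det2 (sandwich F (outer v v))) = P / 4"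
      unfolding ou ov P_def by (rule half, simp add: power2_eq_square)+
    have P0: "0 \<le> P" using psd2_sandwich_outer[of F u] du by (simp add: psd2_def)
    have "(sqrt (P / 4) + sqrt (P / 4))\<^sup>2 = P"
      using P0 by (simp add: real_sqrt_divide)
    then have "c\<^sup>2 + (sqrt (Re (det2 (sandwich F (outer u u)))) + sqrt (Re (det2 (sandwich F (outer v v)))))\<^sup>2
        \<le> Re (det2 (sandwich F id2))"
      unfolding du dv using N(5) by (simp add: P_def)
    moreover have "same_gram Y G" using Y(1) F by (simp add: same_gram_def)
    moreover have "outer u u p q + outer v v p q = id2 p q" for p q by (simp add: uv field_simps)
    ultimately show thesis using that[of Y u v] Y(2) unfolding FG by simp
  qed
qed

section \<open>Ensembles and concurrence\<close>

text \<open>Gaussian elimination in place of the spectral theorem: the rank-one part belonging to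
  \<open>a\<close> is split off, and the remainder, a Schur complement, is again positive. The
  vectors are indexed by \<open>I\<close> itself; for two qubits this yields exactly four of
  them.\<close>

lemma psd_rank_one_decomposition:
  fixes A :: "'a \<Rightarrow> 'a \<Rightarrow> complex"
  assumes "finite I"
    and "\<And>x y. x \<in> I \<Longrightarrow> y \<in> I \<Longrightarrow> A y x = cnj (A x y)"
    and "\<And>v. 0 \<le> Re (\<Sum>x\<in>I. \<Sum>y\<in>I. cnj (v x) * A x y * v y)"
  shows "\<exists>\<phi>. \<forall>x\<in>I. \<forall>y\<in>I. A x y = (\<Sum>k\<in>I. \<phi> k x * cnj (\<phi> k y))"
  using assms
proof (induction I arbitrary: A rule: finite_induct)
  case empty
  show ?case by simp
next
  case (insert a J)
  note herm = insert.prems(1) and psd = insert.prems(2)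
  define \<alpha> where "\<alpha> = Re (A a a)"
  have Aaa: "A a a = of_real \<alpha>"
    using herm[of a a] by (simp add: \<alpha>_def complex_eq_iff)
  define S where "S v = (\<Sum>y\<in>J. A a y * v y)" for v :: "'a \<Rightarrow> complex"
  define Q where "Q v = (\<Sum>x\<in>J. \<Sum>y\<in>J. cnj (v x) * A x y * v y)" for v :: "'a \<Rightarrow> complex"
  have pos: "0 \<le> (cmod t)\<^sup>2 * \<alpha> + 2 * Re (cnj t * S v) + Re (Q v)" for t v
  proof -
    define v' where "v' = v(a := t)"
    have v'J: "v' x = v x" if "x \<in> J" for x using that insert.hyps by (auto simp: v'_def)
    have col: "(\<Sum>x\<in>J. cnj (v x) * A x a) = cnj (S v)"
      unfolding S_def cnj_sum by (intro sum.cong) (auto simp: herm[of a])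
    have "(\<Sum>x\<in>insert a J. \<Sum>y\<in>insert a J. cnj (v' x) * A x y * v' y)
        = cnj t * A a a * t + (\<Sum>y\<in>J. cnj t * A a y * v y) + ((\<Sum>x\<in>J. cnj (v x) * A x a * t) + Q v)"
      using insert.hyps by (simp add: sum.distrib v'J Q_def) (simp add: v'_def)
    also have "(\<Sum>y\<in>J. cnj t * A a y * v y) = cnj t * S v"
      by (simp add: S_def sum_distrib_left mult.assoc)
    also have "(\<Sum>x\<in>J. cnj (v x) * A x a * t) = cnj (cnj t * S v)"
      by (simp add: sum_distrib_left mult_ac flip: col)
    also have "cnj t * A a a * t = of_real ((cmod t)\<^sup>2 * \<alpha>)"
      unfolding of_real_mult complex_norm_square Aaa by simp
    finally show ?thesis using psd[of v'] by simp
  qed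
  have \<alpha>0: "0 \<le> \<alpha>" using pos[of 1 "\<lambda>_. 0"] by (simp add: S_def Q_def)
  \<comment> \<open>Without the quadratic term in \<open>t\<close> the form is affine in
    \<open>t\<close>, so a large multiple of \<open>S v\<close> would make it negative.\<close>
  have S0: "S v = 0" if "\<alpha> = 0" for v
  proof (rule ccontr)
    assume nz: "S v \<noteq> 0"
    define r where "r = (\<bar>Re (Q v)\<bar> + 1) / (cmod (S v))\<^sup>2"
    have "cnj (- of_real r * S v) * S v = - of_real (r * (cmod (S v))\<^sup>2)"
      unfolding of_real_mult complex_norm_square by simp
    also have "r * (cmod (S v))\<^sup>2 = \<bar>Re (Q v)\<bar> + 1" using nz by (simp add: r_def)
    finally show False using pos[of "- of_real r * S v" v] that by simp
  qed
  \<comment> \<open>for \<open>\<alpha> = 0\<close> the division makes \<open>v0\<close> vanish, as it should\<close>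
  define v0 where "v0 x = A x a / of_real (sqrt \<alpha>)" for x
  define B where "B x y = A x y - v0 x * cnj (v0 y)" for x y
  have row: "v0 a * cnj (v0 y) = A a y" if "y \<in> insert a J" for y
  proof (cases "\<alpha> = 0")
    case True
    have "A a y = 0"
    proof (cases "y = a")
      case False
      then have "S (\<lambda>z. if z = y then 1 else 0) = A a y"
        using that insert.hyps by (simp add: S_def if_distrib[of "\<lambda>c. A a _ * c"] cong: if_cong)
      then show ?thesis using S0[OF True] by metis
    qed (use True Aaa in simp)
    then show ?thesis by (simp add: v0_def True)
  next
    case False
    then have "complex_of_real (sqrt \<alpha>) * complex_of_real (sqrt \<alpha>) = of_real \<alpha>"
      using \<alpha>0 by (simp flip: of_real_mult)
    moreover have "complex_of_real \<alpha> \<noteq> 0" using False by simp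
    moreover have "cnj (A y a) = A a y" using herm[of a y] that by simp
    ultimately show ?thesis by (simp add: v0_def Aaa)
  qed
  have QB: "0 \<le> Re (\<Sum>x\<in>J. \<Sum>y\<in>J. cnj (v x) * B x y * v y)" for v
  proof -
    have proj: "(\<Sum>y\<in>J. cnj (v0 y) * v y) = S v / of_real (sqrt \<alpha>)"
      unfolding S_def sum_divide_distrib by (intro sum.cong) (auto simp: v0_def herm[of _ a])
    have "(\<Sum>x\<in>J. \<Sum>y\<in>J. cnj (v x) * B x y * v y)
        = Q v - (\<Sum>x\<in>J. \<Sum>y\<in>J. (cnj (v x) * v0 x) * (cnj (v0 y) * v y))"
      unfolding Q_def sum_subtractf[symmetric] by (intro sum.cong refl) (simp add: B_def algebra_simps)
    also have "(\<Sum>x\<in>J. \<Sum>y\<in>J. (cnj (v x) * v0 x) * (cnj (v0 y) * v y))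
        = cnj (\<Sum>y\<in>J. cnj (v0 y) * v y) * (\<Sum>y\<in>J. cnj (v0 y) * v y)"
      by (simp add: sum_product mult.commute)
    also have "\<dots> = of_real ((cmod (S v / of_real (sqrt \<alpha>)))\<^sup>2)"
      unfolding proj complex_norm_square by (simp add: mult.commute)
    also have "(cmod (S v / of_real (sqrt \<alpha>)))\<^sup>2 = (cmod (S v))\<^sup>2 / \<alpha>"
      using \<alpha>0 by (simp add: norm_divide power_divide)
    finally have eq: "Re (\<Sum>x\<in>J. \<Sum>y\<in>J. cnj (v x) * B x y * v y) = Re (Q v) - (cmod (S v))\<^sup>2 / \<alpha>"
      by simp
    show ?thesis
    proof (cases "\<alpha> = 0")
      case True
      then show ?thesis using pos[of 0 v] eq by simp
    next
      case False
      \<comment> \<open>The value t = - S v / alpha minimises the form; positivity there is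
        positivity of the Schur complement.\<close>
      have "cnj (- (S v / of_real \<alpha>)) * S v = - of_real ((cmod (S v))\<^sup>2 / \<alpha>)"
        unfolding of_real_divide complex_norm_square by (simp add: mult.commute)
      then have "Re (cnj (- (S v / of_real \<alpha>)) * S v) = - ((cmod (S v))\<^sup>2 / \<alpha>)"
        by (simp only: uminus_complex.sel Re_complex_of_real)
      moreover have "(cmod (- (S v / of_real \<alpha>)))\<^sup>2 * \<alpha> = (cmod (S v))\<^sup>2 / \<alpha>"
        using False \<alpha>0 by (simp add: norm_divide power_divide power2_eq_square)
      ultimately show ?thesis using pos[of "- (S v / of_real \<alpha>)" v] eq by linarith
    qed
  qed
  have "B y x = cnj (B x y)" if "x \<in> J" "y \<in> J" for x y
    using herm[of x y] that by (simp add: B_def mult.commute)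
  from insert.IH[OF this QB] obtain \<phi>
    where \<phi>: "\<And>x y. x \<in> J \<Longrightarrow> y \<in> J \<Longrightarrow> B x y = (\<Sum>k\<in>J. \<phi> k x * cnj (\<phi> k y))" by blast
  define \<phi>' where "\<phi>' k x = (if k = a then v0 x else if x = a then 0 else \<phi> k x)" for k x
  have "A x y = (\<Sum>k\<in>insert a J. \<phi>' k x * cnj (\<phi>' k y))" if "x \<in> insert a J" "y \<in> insert a J" for x y
  proof -
    have split: "(\<Sum>k\<in>insert a J. \<phi>' k x * cnj (\<phi>' k y))
        = v0 x * cnj (v0 y) + (\<Sum>k\<in>J. (if x = a then 0 else \<phi> k x) * cnj (if y = a then 0 else \<phi> k y))"
    proof -
      have "(\<Sum>k\<in>J. \<phi>' k x * cnj (\<phi>' k y)) = (\<Sum>k\<in>J. (if x = a then 0 else \<phi> k x) * cnj (if y = a then 0 else \<phi> k y))"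
        using insert.hyps by (intro sum.cong) (auto simp: \<phi>'_def)
      then show ?thesis using insert.hyps by (simp add: \<phi>'_def)
    qed
    consider "x = a" | "y = a" | "x \<in> J" "y \<in> J" "x \<noteq> a" "y \<noteq> a"
      using \<open>x \<in> insert a J\<close> \<open>y \<in> insert a J\<close> by blast
    then show ?thesis
    proof cases
      case 1
      then show ?thesis using split row[OF that(2)] by simp
    next
      case 2
      have "v0 x * cnj (v0 a) = cnj (v0 a * cnj (v0 x))" by simp
      also have "\<dots> = A x a" using row[OF that(1)] herm[of a x] that by simp
      finally show ?thesis using 2 split by simp
    next
      case 3
      then show ?thesis using split \<phi>[OF 3(1,2)] by (simp add: B_def algebra_simps)
    qed
  qed
  then show ?case by blast
qed

section \<open>Sums over bit assignments\<close>

lemma finite_basis_states [simp]: "finite S \<Longrightarrow> finite (basis_states S)"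
  unfolding basis_states_def by (intro finite_PiE) auto

lemma basis_states_empty [simp]: "basis_states {} = {\<lambda>_. undefined}"
  by (simp add: basis_states_def)

lemma basis_states_outside: "y \<in> basis_states Y \<Longrightarrow> i \<notin> Y \<Longrightarrow> y i = undefined"
  unfolding basis_states_def by (rule PiE_arb)

lemma basis_states_upd: "y \<in> basis_states Y \<Longrightarrow> y(q := s) \<in> basis_states (insert q Y)"
  unfolding basis_states_def by (auto intro: PiE_fun_upd)

lemma merge_basis_states: "merge X Y (x, y) \<in> basis_states (X \<union> Y)"
  by (simp add: basis_states_def PiE_def)

lemma sum_basis_states_insert:
  assumes "q \<notin> Y"
  shows "(\<Sum>x\<in>basis_states (insert q Y). f x) = (\<Sum>s\<in>UNIV. \<Sum>y\<in>basis_states Y. f (y(q := s)))"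
proof -
  have "(\<Sum>x\<in>basis_states (insert q Y). f x)
      = (\<Sum>(s, y)\<in>UNIV \<times> basis_states Y. f (y(q := s)))"
    unfolding basis_states_def PiE_insert_eq
    using sum.reindex[OF inj_combinator[OF assms, of "\<lambda>_. UNIV"], of f]
    by (simp add: case_prod_unfold)
  then show ?thesis by (simp add: sum.cartesian_product)
qed

lemma sum_basis_states_Un:
  assumes "X \<inter> Y = {}"
  shows "(\<Sum>w\<in>basis_states (X \<union> Y). f w) = (\<Sum>x\<in>basis_states X. \<Sum>y\<in>basis_states Y. f (merge X Y (x, y)))"
proof -
  have "(\<Sum>w\<in>basis_states (X \<union> Y). f w) = (\<Sum>p\<in>basis_states X \<times> basis_states Y. f (merge X Y p))"
  proof (rule sum.reindex_bij_witness[where j = "\<lambda>w. (restrict w X, restrict w Y)" and i = "merge X Y"])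
    fix w assume w: "w \<in> basis_states (X \<union> Y)"
    then have "w i = undefined" if "i \<notin> X \<union> Y" for i
      using that by (rule basis_states_outside)
    then have "merge X Y (restrict w X, restrict w Y) = w"
      by (auto simp: merge_def fun_eq_iff)
    then show "merge X Y (restrict w X, restrict w Y) = w"
      "f (merge X Y (restrict w X, restrict w Y)) = f w" by simp_all
    show "(restrict w X, restrict w Y) \<in> basis_states X \<times> basis_states Y"
      by (auto simp: basis_states_def)
  next
    fix p assume "p \<in> basis_states X \<times> basis_states Y"
    then have p: "fst p \<in> basis_states X" "snd p \<in> basis_states Y" by auto
    have "fst p i = undefined" if "i \<notin> X" for i
      using basis_states_outside[OF p(1) that] .
    moreover have "snd p i = undefined" if "i \<notin> Y" for i
      using basis_states_outside[OF p(2) that] .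
    ultimately show "(restrict (merge X Y p) X, restrict (merge X Y p) Y) = p"
      "merge X Y p \<in> basis_states (X \<union> Y)"
      using assms merge_basis_states[of X Y "fst p" "snd p"]
      by (auto simp: merge_def prod_eq_iff fun_eq_iff restrict_def)
  qed
  then show ?thesis by (simp add: sum.cartesian_product case_prod_unfold)
qed

text \<open>Unnormalised vectors absorb the weights of a decomposition and the index set is
  arbitrary. This makes slices, products and re-mixing available without a normalisation at each
  step.\<close>

definition ensemble :: "'q set \<Rightarrow> 'i set \<Rightarrow> ('i \<Rightarrow> 'q vec) \<Rightarrow> 'q oper \<Rightarrow> bool" where
  "ensemble S I \<phi> \<rho> \<longleftrightarrow> (\<forall>x\<in>basis_states S. \<forall>y\<in>basis_states S. \<rho> x y = (\<Sum>i\<in>I. \<phi> i x * cnj (\<phi> i y)))"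

lemma ensemble_exists:
  assumes "finite S" "positive_semidefinite S \<rho>"
  shows "\<exists>\<phi>. ensemble S (basis_states S) \<phi> \<rho>"
  unfolding ensemble_def
  using assms(2) unfolding positive_semidefinite_def
  by (intro psd_rank_one_decomposition finite_basis_states assms(1)) blast+

lemma op_trace_reduced:
  assumes "T \<subseteq> S"
  shows "op_trace T (reduced S T \<rho>) = op_trace S \<rho>"
proof -
  have "T \<union> (S - T) = S" "T \<inter> (S - T) = {}" using assms by auto
  then show ?thesis
    using sum_basis_states_Un[of T "S - T" "\<lambda>x. \<rho> x x"] by (simp add: op_trace_def reduced_def)
qed

lemma reduced_reduced:
  assumes "X \<subseteq> T" "T \<subseteq> S"
  shows "reduced T X (reduced S T \<rho>) = reduced S X \<rho>"
proof (intro ext)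
  fix x y
  have eq: "S - X = (T - X) \<union> (S - T)" and disj: "(T - X) \<inter> (S - T) = {}" using assms by auto
  have m: "merge X (S - X) (w, merge (T - X) (S - T) (u, v)) = merge T (S - T) (merge X (T - X) (w, u), v)" for w u v
    using assms by (auto simp: merge_def fun_eq_iff)
  have "reduced S X \<rho> x y = (\<Sum>u\<in>basis_states (T - X). \<Sum>v\<in>basis_states (S - T).
     \<rho> (merge X (S - X) (x, merge (T - X) (S - T) (u, v))) (merge X (S - X) (y, merge (T - X) (S - T) (u, v))))"
    unfolding reduced_def
    using sum_basis_states_Un[OF disj, of "\<lambda>z. \<rho> (merge X (S - X) (x, z)) (merge X (S - X) (y, z))"]
    by (simp flip: eq)
  then show "reduced T X (reduced S T \<rho>) x y = reduced S X \<rho> x y"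
    unfolding m by (simp add: reduced_def)
qed

lemma ensemble_reduced_sum:
  assumes "ensemble S I \<phi> \<rho>" "T \<subseteq> S"
  shows "reduced S T \<rho> x y = (\<Sum>i\<in>I. reduced S T (projector (\<phi> i)) x y)"
proof -
  have "merge T (S - T) (w, z) \<in> basis_states S" for w z
    using merge_basis_states[of T "S - T"] assms(2) by (simp add: Un_absorb1)
  then show ?thesis
    using assms(1) unfolding reduced_def ensemble_def projector_def by (subst sum.swap) simp
qed

lemma ensemble_reduced:
  assumes "ensemble S I \<phi> \<rho>" "T \<subseteq> S"
  shows "ensemble T (I \<times> basis_states (S - T)) (\<lambda>(i, z) x. \<phi> i (merge T (S - T) (x, z))) (reduced S T \<rho>)"
  unfolding ensemble_def ensemble_reduced_sum[OF assms]
  by (simp add: reduced_def projector_def sum.cartesian_product case_prod_unfold)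

section \<open>Concurrence of unnormalised vectors with respect to a qubit\<close>

definition marginal :: "'q \<Rightarrow> 'q set \<Rightarrow> 'q vec \<Rightarrow> mat2" where
  "marginal q Y \<phi> = (\<lambda>s t. \<Sum>y\<in>basis_states Y. \<phi> (y(q := s)) * cnj (\<phi> (y(q := t))))"

text \<open>For a qubit state m of trace one, 2 (1 - tr m^2) = 4 det m. The right side also makes
  sense for unnormalised vectors, where its root is homogeneous of degree two, so a weight p_i can
  be moved into the vector as sqrt(p_i).\<close>

definition vec_concurrence :: "'q \<Rightarrow> 'q set \<Rightarrow> 'q vec \<Rightarrow> real" where
  "vec_concurrence q Y \<phi> = 2 * sqrt (Re (det2 (marginal q Y \<phi>)))"

lemma psd2_marginal: "finite Y \<Longrightarrow> psd2 (marginal q Y \<phi>)"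
  using psd2_sum[of "basis_states Y" "\<lambda>y. outer (\<lambda>s. \<phi> (y(q := s))) (\<lambda>s. \<phi> (y(q := s)))"] psd2_outer
  by (simp add: outer_def marginal_def)

lemma vec_concurrence_nonneg: "finite Y \<Longrightarrow> 0 \<le> vec_concurrence q Y \<phi>"
  using psd2_marginal[of Y q \<phi>] by (simp add: vec_concurrence_def psd2_def)

lemma vec_concurrence_scale: "vec_concurrence q Y (\<lambda>x. c * \<phi> x) = (cmod c)\<^sup>2 * vec_concurrence q Y \<phi>"
proof -
  have "marginal q Y (\<lambda>x. c * \<phi> x) = (\<lambda>s t. of_real ((cmod c)\<^sup>2) * marginal q Y \<phi> s t)"
    unfolding marginal_def complex_norm_square sum_distrib_left by (simp add: mult_ac)
  then have "Re (det2 (marginal q Y (\<lambda>x. c * \<phi> x))) = ((cmod c)\<^sup>2)\<^sup>2 * Re (det2 (marginal q Y \<phi>))"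
    by (simp only: det2_scale flip: of_real_power) simp
  then show ?thesis
    unfolding vec_concurrence_def by (simp only: real_sqrt_mult real_sqrt_abs) simp
qed

lemma vec_concurrence_cong:
  assumes "\<And>x. x \<in> basis_states (insert q Y) \<Longrightarrow> \<phi> x = \<psi> x"
  shows "vec_concurrence q Y \<phi> = vec_concurrence q Y \<psi>"
  using assms by (simp add: vec_concurrence_def marginal_def basis_states_upd)

lemma merge_single:
  assumes "y \<in> basis_states Y" "q \<notin> Y"
  shows "merge {q} Y (x, y) = y(q := x q)"
proof
  fix i
  show "merge {q} Y (x, y) i = (y(q := x q)) i"
    using assms basis_states_outside[OF assms(1), of i] by (auto simp: merge_def)
qed

lemma trace_marginal:
  assumes "q \<notin> Y"
  shows "marginal q Y \<psi> False False + marginal q Y \<psi> True True = of_real (\<Sum>x\<in>basis_states (insert q Y). (cmod (\<psi> x))\<^sup>2)"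
  unfolding sum_basis_states_insert[OF assms] marginal_def of_real_sum complex_norm_square
  by (simp add: UNIV_bool)

lemma concurrence_pure_eq:
  assumes q: "q \<notin> Y" and pure: "pure_state ({q} \<union> Y) \<psi>"
  shows "concurrence_pure {q} Y \<psi> = vec_concurrence q Y \<psi>"
proof -
  define m where "m = marginal q Y \<psi>"
  have Y: "insert q Y - {q} = Y" using q by auto
  have red: "reduced ({q} \<union> Y) {q} (projector \<psi>) x y = m (x q) (y q)" for x y
    using q by (simp add: reduced_def projector_def Y m_def marginal_def merge_single cong: sum.cong)
  have one: "(\<Sum>x\<in>basis_states {q}. f x) = f ((\<lambda>_. undefined)(q := False)) + f ((\<lambda>_. undefined)(q := True))" for f :: "_ \<Rightarrow> complex"
  proof -
    have "q \<notin> {}" by simp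
    have single: "(\<Sum>y\<in>{u}. g y) = g u" for u and g :: "_ \<Rightarrow> complex" by simp
    have two: "(\<Sum>s\<in>UNIV. g s) = g False + g True" for g :: "bool \<Rightarrow> complex"
      by (simp add: UNIV_bool)
    have "(\<Sum>x\<in>basis_states {q}. f x) = (\<Sum>s\<in>UNIV. f ((\<lambda>_. undefined)(q := s)))"
      unfolding sum_basis_states_insert[OF \<open>q \<notin> {}\<close>] basis_states_empty single ..
    also have "\<dots> = f ((\<lambda>_. undefined)(q := False)) + f ((\<lambda>_. undefined)(q := True))"
      by (rule two)
    finally show ?thesis .
  qed
  have tr: "m False False + m True True = 1"
    using trace_marginal[OF q, of \<psi>] pure by (simp add: m_def pure_state_def del: of_real_sum)
  define tr2 where "tr2 = op_trace {q} (op_mult {q} (reduced ({q} \<union> Y) {q} (projector \<psi>)) (reduced ({q} \<union> Y) {q} (projector \<psi>)))"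
  have "tr2 = m False False * m False False + 2 * (m False True * m True False) + m True True * m True True"
    unfolding tr2_def op_trace_def op_mult_def red one fun_upd_same by (simp add: algebra_simps)
  also have "\<dots> = (m False False + m True True)\<^sup>2 - 2 * det2 m"
    by (simp add: det2_def power2_eq_square algebra_simps)
  finally have "tr2 = 1 - 2 * det2 m" unfolding tr by simp
  then have "2 * (1 - Re tr2) = 4 * Re (det2 m)" by simp
  then show ?thesis
    unfolding concurrence_pure_def Let_def tr2_def[symmetric] vec_concurrence_def m_def[symmetric]
    by (simp add: real_sqrt_mult)
qed

section \<open>Ensembles versus pure state decompositions\<close>

lemma pure_decomposition_of_ensemble:
  assumes fin: "finite Y" "finite I" and q: "q \<notin> Y"
    and ens: "ensemble ({q} \<union> Y) I \<phi> \<sigma>" and tr: "op_trace ({q} \<union> Y) \<sigma> = 1"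
  obtains n p \<psi> where "pure_decomposition ({q} \<union> Y) \<sigma> n p \<psi>"
    "(\<Sum>i<n. p i * concurrence_pure {q} Y (\<psi> i)) = (\<Sum>i\<in>I. vec_concurrence q Y (\<phi> i))"
proof -
  let ?S = "{q} \<union> Y"
  have finS: "finite (basis_states ?S)" using fin by simp
  obtain h where h: "bij_betw h {..<card I} I"
    using ex_bij_betw_nat_finite[OF fin(2)] by (auto simp: atLeast0LessThan)
  define n where "n = card I"
  define P where "P i = (\<Sum>x\<in>basis_states ?S. (cmod (\<phi> i x))\<^sup>2)" for i
  have P0: "0 \<le> P i" for i by (simp add: P_def sum_nonneg)
  have zero: "\<phi> i x = 0" if "P i = 0" "x \<in> basis_states ?S" for i x
    using that finS by (simp add: P_def sum_nonneg_eq_0_iff)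
  define x0 where "x0 = restrict (\<lambda>_. True) ?S"
  have x0: "x0 \<in> basis_states ?S" by (auto simp: x0_def basis_states_def)
  \<comment> \<open>A vector of norm zero cannot be normalised; it gets an arbitrary basis state,
    which its weight \<open>P i = 0\<close> renders harmless.\<close>
  define \<Psi> where "\<Psi> i = (if P i = 0 then (\<lambda>x. if x = x0 then 1 else 0) else (\<lambda>x. of_real (1 / sqrt (P i)) * \<phi> i x))" for i
  have pure: "pure_state ?S (\<Psi> i)" for i
  proof (cases "P i = 0")
    case True
    have "(\<Sum>x\<in>basis_states ?S. (cmod (\<Psi> i x))\<^sup>2) = (\<Sum>x\<in>basis_states ?S. if x = x0 then 1 else 0)"
      by (intro sum.cong) (auto simp: \<Psi>_def True)
    then show ?thesis using x0 finS by (simp add: pure_state_def)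
  next
    case False
    have "(\<Sum>x\<in>basis_states ?S. (cmod (\<Psi> i x))\<^sup>2) = (\<Sum>x\<in>basis_states ?S. (cmod (\<phi> i x))\<^sup>2 / P i)"
      by (intro sum.cong) (use False P0 in \<open>auto simp: \<Psi>_def norm_mult norm_divide power_divide\<close>)
    also have "\<dots> = 1" using False by (simp add: P_def flip: sum_divide_distrib)
    finally show ?thesis by (simp add: pure_state_def)
  qed
  have proj: "of_real (P i) * projector (\<Psi> i) x y = \<phi> i x * cnj (\<phi> i y)"
    if "x \<in> basis_states ?S" "y \<in> basis_states ?S" for i x y
  proof (cases "P i = 0")
    case False
    have "complex_of_real (sqrt (P i)) * complex_of_real (sqrt (P i)) = of_real (P i)"
      using P0 by (simp flip: of_real_mult)
    then show ?thesis using False by (simp add: projector_def \<Psi>_def)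
  qed (use zero that in simp)
  have conc: "P i * concurrence_pure {q} Y (\<Psi> i) = vec_concurrence q Y (\<phi> i)" for i
  proof (cases "P i = 0")
    case True
    have "vec_concurrence q Y (\<phi> i) = vec_concurrence q Y (\<lambda>x. 0 * \<phi> i x)"
      by (rule vec_concurrence_cong) (use zero[OF True] in simp)
    also have "\<dots> = 0" by (simp only: vec_concurrence_scale) simp
    finally show ?thesis using True by simp
  next
    case False
    have "\<Psi> i = (\<lambda>x. of_real (1 / sqrt (P i)) * \<phi> i x)" using False by (simp add: \<Psi>_def)
    then have "vec_concurrence q Y (\<Psi> i) = (1 / sqrt (P i))\<^sup>2 * vec_concurrence q Y (\<phi> i)"
      using P0[of i] by (simp only: vec_concurrence_scale norm_of_real) simp
    then show ?thesis
      using P0[of i] False by (simp add: concurrence_pure_eq[OF q pure] power_divide)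
  qed
  have reindex: "(\<Sum>i<n. g (h i)) = (\<Sum>i\<in>I. g i)" for g :: "_ \<Rightarrow> 'z::comm_monoid_add"
    unfolding n_def by (rule sum.reindex_bij_betw[OF h])
  have "complex_of_real (\<Sum>i\<in>I. P i) = (\<Sum>i\<in>I. \<Sum>x\<in>basis_states ?S. \<phi> i x * cnj (\<phi> i x))"
    unfolding P_def of_real_sum complex_norm_square ..
  also have "\<dots> = op_trace ?S \<sigma>"
    using ens unfolding op_trace_def ensemble_def by (subst sum.swap) simp
  finally have "(\<Sum>i\<in>I. P i) = 1" using tr by (metis of_real_eq_1_iff)
  then have sumP: "(\<Sum>i<n. P (h i)) = 1" by (simp add: reindex)
  show thesis
  proof (rule that[of n "\<lambda>i. P (h i)" "\<lambda>i. \<Psi> (h i)"])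
    have "\<sigma> x y = (\<Sum>i<n. of_real (P (h i)) * projector (\<Psi> (h i)) x y)"
      if "x \<in> basis_states ?S" "y \<in> basis_states ?S" for x y
      using ens that reindex[of "\<lambda>i. \<phi> i x * cnj (\<phi> i y)"] by (simp add: proj ensemble_def)
    then show "pure_decomposition ?S \<sigma> n (\<lambda>i. P (h i)) (\<lambda>i. \<Psi> (h i))"
      unfolding pure_decomposition_def using P0 pure sumP by blast
    show "(\<Sum>i<n. P (h i) * concurrence_pure {q} Y (\<Psi> (h i))) = (\<Sum>i\<in>I. vec_concurrence q Y (\<phi> i))"
      unfolding conc by (rule reindex)
  qed
qed

lemma ensemble_of_pure_decomposition:
  assumes "q \<notin> Y" "pure_decomposition ({q} \<union> Y) \<sigma> n p \<psi>"
  shows "ensemble ({q} \<union> Y) {..<n} (\<lambda>i x. of_real (sqrt (p i)) * \<psi> i x) \<sigma>"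
    and "(\<Sum>i<n. p i * concurrence_pure {q} Y (\<psi> i)) = (\<Sum>i<n. vec_concurrence q Y (\<lambda>x. of_real (sqrt (p i)) * \<psi> i x))"
proof -
  have p: "0 \<le> p i" "pure_state ({q} \<union> Y) (\<psi> i)" if "i < n" for i
    using assms that by (auto simp: pure_decomposition_def)
  have "complex_of_real (sqrt (p i)) * complex_of_real (sqrt (p i)) = of_real (p i)" if "i < n" for i
    using p(1)[OF that] by (simp flip: of_real_mult)
  then have "(of_real (sqrt (p i)) * \<psi> i x) * cnj (of_real (sqrt (p i)) * \<psi> i y) = of_real (p i) * projector (\<psi> i) x y"
    if "i < n" for i x y
    using that by (simp add: projector_def mult_ac)
  then show "ensemble ({q} \<union> Y) {..<n} (\<lambda>i x. of_real (sqrt (p i)) * \<psi> i x) \<sigma>"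
    using assms(2) by (simp add: ensemble_def pure_decomposition_def)
  show "(\<Sum>i<n. p i * concurrence_pure {q} Y (\<psi> i)) = (\<Sum>i<n. vec_concurrence q Y (\<lambda>x. of_real (sqrt (p i)) * \<psi> i x))"
    by (intro sum.cong) (use p in \<open>auto simp: vec_concurrence_scale concurrence_pure_eq[OF assms(1)]\<close>)
qed

lemma concurrence_le_ensemble:
  assumes "finite Y" "finite I" "q \<notin> Y"
    and "ensemble ({q} \<union> Y) I \<phi> \<sigma>" "op_trace ({q} \<union> Y) \<sigma> = 1"
  shows "concurrence {q} Y \<sigma> \<le> (\<Sum>i\<in>I. vec_concurrence q Y (\<phi> i))"
proof -
  let ?V = "{\<Sum>i<n. p i * concurrence_pure {q} Y (\<psi> i) | n p \<psi>. pure_decomposition ({q} \<union> Y) \<sigma> n p \<psi>}"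
  have "bdd_below ?V"
  proof (rule bdd_belowI[of _ 0])
    fix v assume "v \<in> ?V"
    then obtain n p \<psi> where v: "pure_decomposition ({q} \<union> Y) \<sigma> n p \<psi>" "v = (\<Sum>i<n. p i * concurrence_pure {q} Y (\<psi> i))"
      by blast
    show "0 \<le> v"
      unfolding v(2) ensemble_of_pure_decomposition(2)[OF assms(3) v(1)]
      by (intro sum_nonneg vec_concurrence_nonneg assms(1))
  qed
  moreover obtain n p \<psi> where d: "pure_decomposition ({q} \<union> Y) \<sigma> n p \<psi>"
    "(\<Sum>i<n. p i * concurrence_pure {q} Y (\<psi> i)) = (\<Sum>i\<in>I. vec_concurrence q Y (\<phi> i))"
    by (rule pure_decomposition_of_ensemble[OF assms])
  have "(\<Sum>i\<in>I. vec_concurrence q Y (\<phi> i)) \<in> ?V"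
    using d(1) d(2)[symmetric] by blast
  ultimately show ?thesis
    unfolding concurrence_def by (intro cInf_lower)
qed

text \<open>The ensemble \<open>\<xi>\<close> witnesses that the set of values is nonempty, without
  which its \<open>Inf\<close> would say nothing.\<close>

lemma concurrence_ge:
  assumes "finite Y" "finite J" "q \<notin> Y"
    and "ensemble ({q} \<union> Y) J \<xi> \<sigma>" "op_trace ({q} \<union> Y) \<sigma> = 1"
    and ge: "\<And>n \<phi>. ensemble ({q} \<union> Y) {..<n::nat} \<phi> \<sigma> \<Longrightarrow> B \<le> (\<Sum>i<n. vec_concurrence q Y (\<phi> i))"
  shows "B \<le> concurrence {q} Y \<sigma>"
  unfolding concurrence_def
proof (rule cInf_greatest)
  obtain n p \<psi> where "pure_decomposition ({q} \<union> Y) \<sigma> n p \<psi>"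
    by (rule pure_decomposition_of_ensemble[OF assms(1-5)])
  then show "{\<Sum>i<n. p i * concurrence_pure {q} Y (\<psi> i) | n p \<psi>. pure_decomposition ({q} \<union> Y) \<sigma> n p \<psi>} \<noteq> {}"
    by blast
  fix v assume "v \<in> {\<Sum>i<n. p i * concurrence_pure {q} Y (\<psi> i) | n p \<psi>. pure_decomposition ({q} \<union> Y) \<sigma> n p \<psi>}"
  then obtain n p \<psi> where v: "pure_decomposition ({q} \<union> Y) \<sigma> n p \<psi>" "v = (\<Sum>i<n. p i * concurrence_pure {q} Y (\<psi> i))"
    by blast
  show "B \<le> v"
    unfolding v(2) ensemble_of_pure_decomposition(2)[OF assms(3) v(1)]
    by (rule ge[OF ensemble_of_pure_decomposition(1)[OF assms(3) v(1)]])
qed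

lemma vec_concurrence_le:
  assumes "finite Y" "q \<notin> Y"
  shows "vec_concurrence q Y \<phi> \<le> (\<Sum>x\<in>basis_states (insert q Y). (cmod (\<phi> x))\<^sup>2)"
proof -
  define m where "m = marginal q Y \<phi>"
  have psd: "psd2 m" unfolding m_def by (rule psd2_marginal[OF assms(1)])
  define p r where "p = Re (m False False)" "r = Re (m True True)"
  note pr = p_r_def
  have "Re (det2 m) \<le> p * r"
    using psd Re_det2_hermitian[of m] by (simp add: psd2_def pr)
  also have "4 * (p * r) \<le> (p + r)\<^sup>2"
    using zero_le_power2[of "p - r"] by (simp add: power2_eq_square algebra_simps)
  finally have "4 * Re (det2 m) \<le> (p + r)\<^sup>2" by simp
  then have "sqrt (4 * Re (det2 m)) \<le> p + r"
    using psd by (intro real_le_lsqrt) (auto simp: psd2_def pr)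
  then have "vec_concurrence q Y \<phi> \<le> p + r"
    by (simp add: vec_concurrence_def m_def real_sqrt_mult)
  also have "p + r = (\<Sum>x\<in>basis_states (insert q Y). (cmod (\<phi> x))\<^sup>2)"
    using arg_cong[OF trace_marginal[OF assms(2), of \<phi>], of Re] by (simp add: pr m_def)
  finally show ?thesis .
qed

text \<open>Twice the root of the determinant of a positive matrix is at most its trace, and the
  traces of an ensemble add up to 1. The upper bound is what later places the factors of the second
  product in [0,1].\<close>

lemma concurrence_bounds:
  assumes "finite Y" "finite I" "q \<notin> Y"
    and "ensemble ({q} \<union> Y) I \<phi> \<sigma>" "op_trace ({q} \<union> Y) \<sigma> = 1"
  shows "0 \<le> concurrence {q} Y \<sigma>" "concurrence {q} Y \<sigma> \<le> 1"
proof -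
  show "0 \<le> concurrence {q} Y \<sigma>"
    by (rule concurrence_ge[OF assms]) (intro sum_nonneg vec_concurrence_nonneg assms(1))
  have "concurrence {q} Y \<sigma> \<le> (\<Sum>i\<in>I. vec_concurrence q Y (\<phi> i))"
    by (rule concurrence_le_ensemble[OF assms])
  also have "\<dots> \<le> (\<Sum>i\<in>I. \<Sum>x\<in>basis_states ({q} \<union> Y). (cmod (\<phi> i x))\<^sup>2)"
    using vec_concurrence_le[OF assms(1,3)] by (intro sum_mono) simp
  also have "\<dots> = 1"
  proof -
    have "complex_of_real (\<Sum>i\<in>I. \<Sum>x\<in>basis_states ({q} \<union> Y). (cmod (\<phi> i x))\<^sup>2) = op_trace ({q} \<union> Y) \<sigma>"
      using assms(4) unfolding op_trace_def ensemble_def of_real_sum complex_norm_square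
      by (subst sum.swap) simp
    then show ?thesis unfolding assms(5) by (metis of_real_eq_1_iff)
  qed
  finally show "concurrence {q} Y \<sigma> \<le> 1" .
qed

section \<open>Monogamy\<close>

lemma reduced_projector_merge:
  assumes "T = X \<union> Z" "X \<inter> Z = {}"
  shows "reduced T X (projector \<phi>) x y
    = (\<Sum>z\<in>basis_states Z. \<phi> (merge X Z (x, z)) * cnj (\<phi> (merge X Z (y, z))))"
proof -
  have "T - X = Z" using assms by auto
  then show ?thesis by (simp add: reduced_def projector_def)
qed

lemma merge_pair:
  assumes "z \<in> basis_states Z" "q \<notin> Z" "b \<notin> Z"
  shows "merge {q, b} Z (x, z) = z(b := x b, q := x q)"
proof
  fix i
  show "merge {q, b} Z (x, z) i = (z(b := x b, q := x q)) i"
    using assms basis_states_outside[OF assms(1), of i] by (auto simp: merge_def)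
qed

lemma merge_upd:
  assumes "x \<in> basis_states X" "b \<notin> X"
  shows "merge X {b} (x, z) = x(b := z b)"
proof
  fix i
  show "merge X {b} (x, z) i = (x(b := z b)) i"
    using assms basis_states_outside[OF assms(1), of i] by (auto simp: merge_def)
qed

lemma sum_bool: "(\<Sum>s\<in>UNIV. g s) = g False + g True" for g :: "bool \<Rightarrow> 'a::comm_monoid_add"
  by (simp add: UNIV_bool add.commute)

text \<open>The passage to two qubits. \<open>A\<close> is rho_AB in coordinates, and its four
  amplitude matrices form \<open>G\<close>. The vectors \<open>\<mu>\<close> re-mix them, while
  \<open>\<nu>\<close> contracts the qubit \<open>b\<close> of \<open>\<phi>\<close> with
  \<open>u\<close> or \<open>v\<close>. All marginals on \<open>q\<close> of the contracted vectors
  are sandwiches of \<open>G\<close>, which is why the bound from \<open>two_qubit_tradeoff\<close>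
  applies to \<open>C\<close> of any size.\<close>

lemma pure_tradeoff:
  fixes \<phi> :: "'q vec"
  assumes C: "finite C" "q \<notin> C" "b \<notin> C" "q \<noteq> b"
  defines "T \<equiv> {q} \<union> insert b C"
  obtains \<mu> :: "bool \<times> bool \<Rightarrow> 'q vec" and \<nu> :: "bool \<Rightarrow> 'q vec"
  where "ensemble ({q} \<union> {b}) UNIV \<mu> (reduced T ({q} \<union> {b}) (projector \<phi>))"
    "ensemble ({q} \<union> C) UNIV \<nu> (reduced T ({q} \<union> C) (projector \<phi>))"
    "(\<Sum>k\<in>UNIV. vec_concurrence q {b} (\<mu> k))\<^sup>2 + (\<Sum>k\<in>UNIV. vec_concurrence q C (\<nu> k))\<^sup>2
      \<le> (vec_concurrence q (insert b C) \<phi>)\<^sup>2"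
proof -
  define A where "A = (\<lambda>u v. \<Sum>c\<in>basis_states C.
    \<phi> (c(b := snd u, q := fst u)) * cnj (\<phi> (c(b := snd v, q := fst v))))"
  have "\<exists>\<xi> :: bool \<times> bool \<Rightarrow> bool \<times> bool \<Rightarrow> complex. \<forall>x\<in>UNIV. \<forall>y\<in>UNIV. A x y = (\<Sum>k\<in>UNIV. \<xi> k x * cnj (\<xi> k y))"
  proof (rule psd_rank_one_decomposition)
    show "A y x = cnj (A x y)" for x y by (simp add: A_def mult.commute)
    fix v :: "bool \<times> bool \<Rightarrow> complex"
    let ?w = "\<lambda>c. \<Sum>x\<in>UNIV. cnj (v x) * \<phi> (c(b := snd x, q := fst x))"
    have "(\<Sum>x\<in>UNIV. \<Sum>y\<in>UNIV. cnj (v x) * A x y * v y)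
        = (\<Sum>x\<in>UNIV. \<Sum>y\<in>UNIV. \<Sum>c\<in>basis_states C. (cnj (v x) * \<phi> (c(b := snd x, q := fst x)))
            * cnj (cnj (v y) * \<phi> (c(b := snd y, q := fst y))))"
      by (simp add: A_def sum_distrib_left sum_distrib_right mult_ac)
    also have "\<dots> = (\<Sum>c\<in>basis_states C. ?w c * cnj (?w c))"
      unfolding cnj_sum sum_product
      by (subst sum.swap[of _ "basis_states C" UNIV], subst sum.swap[of _ "basis_states C" UNIV]) (rule refl)
    also have "\<dots> = of_real (\<Sum>c\<in>basis_states C. (cmod (?w c))\<^sup>2)"
      unfolding of_real_sum complex_norm_square ..
    finally show "0 \<le> Re (\<Sum>x\<in>UNIV. \<Sum>y\<in>UNIV. cnj (v x) * A x y * v y)"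
      by (simp only: Re_complex_of_real) (simp add: sum_nonneg)
  qed simp
  then obtain \<xi> :: "bool \<times> bool \<Rightarrow> bool \<times> bool \<Rightarrow> complex" where \<xi>: "\<And>x y. A x y = (\<Sum>k\<in>UNIV. \<xi> k x * cnj (\<xi> k y))" by blast
  define G where "G k s p = \<xi> k (s, p)" for k s p
  have GA: "(\<Sum>k\<in>UNIV. G k s p * cnj (G k t r)) = A (s, p) (t, r)" for s p t r
    by (simp add: G_def \<xi>)
  have sand: "sandwich G Z s t = (\<Sum>p\<in>UNIV. \<Sum>r\<in>UNIV. A (s, p) (t, r) * Z p r)" for Z s t
    by (simp add: sandwich_def GA)
  have "\<exists>Y u v. same_gram Y G \<and> (\<forall>p q. outer u u p q + outer v v p q = id2 p q) \<and>
    (\<Sum>i\<in>UNIV. cmod (det2 (Y i)))\<^sup>2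
      + (sqrt (Re (det2 (sandwich G (outer u u)))) + sqrt (Re (det2 (sandwich G (outer v v)))))\<^sup>2
      \<le> Re (det2 (sandwich G id2))"
    by (rule two_qubit_tradeoff[of G]) (simp, blast)
  then obtain Y u v where Y: "same_gram Y G" and uv: "\<And>p q. outer u u p q + outer v v p q = id2 p q"
    and ineq: "(\<Sum>i\<in>UNIV. cmod (det2 (Y i)))\<^sup>2
      + (sqrt (Re (det2 (sandwich G (outer u u)))) + sqrt (Re (det2 (sandwich G (outer v v)))))\<^sup>2
      \<le> Re (det2 (sandwich G id2))"
    by blast
  have YA: "(\<Sum>k\<in>UNIV. Y k s p * cnj (Y k t r)) = A (s, p) (t, r)" for s p t r
    using Y by (simp add: same_gram_def GA)
  define \<mu> :: "bool \<times> bool \<Rightarrow> 'q vec" where "\<mu> k x = Y k (x q) (x b)" for k x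
  define w where "w k = (if k then v else u)" for k
  define \<nu> :: "bool \<Rightarrow> 'q vec" where "\<nu> k x = (\<Sum>p\<in>UNIV. w k p * \<phi> (x(b := p)))" for k x
  have ens1: "ensemble ({q} \<union> {b}) UNIV \<mu> (reduced T ({q} \<union> {b}) (projector \<phi>))"
  proof -
    have T: "T = {q, b} \<union> C" "{q, b} \<inter> C = {}" using C by (auto simp: T_def)
    have "reduced T {q, b} (projector \<phi>) x y = A (x q, x b) (y q, y b)" for x y
      unfolding reduced_projector_merge[OF T] A_def
      by (intro sum.cong refl) (simp add: merge_pair C)
    moreover have "{q} \<union> {b} = {q, b}" by blast
    ultimately show ?thesis by (simp only: ensemble_def \<mu>_def YA) blast
  qed
  have ens2: "ensemble ({q} \<union> C) UNIV \<nu> (reduced T ({q} \<union> C) (projector \<phi>))"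
    unfolding ensemble_def
  proof (intro ballI)
    fix x y assume xy: "x \<in> basis_states ({q} \<union> C)" "y \<in> basis_states ({q} \<union> C)"
    have T: "T = ({q} \<union> C) \<union> {b}" "({q} \<union> C) \<inter> {b} = {}" using C by (auto simp: T_def)
    have b: "b \<notin> {}" "b \<notin> {q} \<union> C" using C by auto
    have single: "(\<Sum>y\<in>{u}. g y) = g u" for u and g :: "_ \<Rightarrow> complex" by simp
    have "reduced T ({q} \<union> C) (projector \<phi>) x y = (\<Sum>p\<in>UNIV. \<phi> (x(b := p)) * cnj (\<phi> (y(b := p))))"
      unfolding reduced_projector_merge[OF T] sum_basis_states_insert[OF b(1)] basis_states_empty single
        merge_upd[OF xy(1) b(2)] merge_upd[OF xy(2) b(2)] fun_upd_same ..
    \<comment> \<open>The identity on qubit \<open>b\<close> is resolved by the two measurement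
      vectors; each resulting term is one member of the ensemble.\<close>
    also have "\<dots> = (\<Sum>p\<in>UNIV. \<Sum>r\<in>UNIV. (outer u u p r + outer v v p r) * (\<phi> (x(b := p)) * cnj (\<phi> (y(b := r)))))"
      unfolding uv sum_bool id2_def by simp
    also have "\<dots> = (\<Sum>k\<in>UNIV. \<nu> k x * cnj (\<nu> k y))"
      unfolding \<nu>_def w_def outer_def sum_bool by (simp add: algebra_simps)
    finally show "reduced T ({q} \<union> C) (projector \<phi>) x y = (\<Sum>k\<in>UNIV. \<nu> k x * cnj (\<nu> k y))" .
  qed
  have conc1: "vec_concurrence q {b} (\<mu> k) = 2 * cmod (det2 (Y k))" for k
  proof -
    have b: "b \<notin> {}" by simp
    have single: "(\<Sum>y\<in>{u}. g y) = g u" for u and g :: "_ \<Rightarrow> complex" by simp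
    have "marginal q {b} (\<mu> k) = (\<lambda>s t. \<Sum>p\<in>UNIV. Y k s p * cnj (Y k t p))"
      unfolding marginal_def sum_basis_states_insert[OF b] basis_states_empty single \<mu>_def
      using C(4) by simp
    then show ?thesis by (simp add: vec_concurrence_def psd2_mult_adjoint(2))
  qed
  have conc2: "vec_concurrence q C (\<nu> k) = 2 * sqrt (Re (det2 (sandwich G (outer (w k) (w k)))))" for k
  proof -
    have "marginal q C (\<nu> k) s t = sandwich G (outer (w k) (w k)) s t" for s t
    proof -
      have "marginal q C (\<nu> k) s t = (\<Sum>c\<in>basis_states C. \<Sum>p\<in>UNIV. \<Sum>r\<in>UNIV.
          (\<phi> (c(b := p, q := s)) * cnj (\<phi> (c(b := r, q := t)))) * (w k p * cnj (w k r)))"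
        unfolding marginal_def \<nu>_def cnj_sum sum_product fun_upd_twist[OF C(4)]
        by (simp add: mult_ac)
      also have "\<dots> = (\<Sum>p\<in>UNIV. \<Sum>r\<in>UNIV. \<Sum>c\<in>basis_states C.
          (\<phi> (c(b := p, q := s)) * cnj (\<phi> (c(b := r, q := t)))) * (w k p * cnj (w k r)))"
        by (subst sum.swap, intro sum.cong refl sum.swap)
      also have "\<dots> = sandwich G (outer (w k) (w k)) s t"
        by (simp add: sand A_def outer_def sum_distrib_right)
      finally show ?thesis .
    qed
    then have "marginal q C (\<nu> k) = sandwich G (outer (w k) (w k))" by (intro ext)
    then show ?thesis by (simp add: vec_concurrence_def)
  qed
  have conc: "vec_concurrence q (insert b C) \<phi> = 2 * sqrt (Re (det2 (sandwich G id2)))"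
  proof -
    have "marginal q (insert b C) \<phi> s t = sandwich G id2 s t" for s t
      unfolding marginal_def sum_basis_states_insert[OF C(3)] sand id2_def
      by (simp add: A_def sum_bool)
    then have "marginal q (insert b C) \<phi> = sandwich G id2" by (intro ext)
    then show ?thesis by (simp add: vec_concurrence_def)
  qed
  have pos: "0 \<le> Re (det2 (sandwich G id2))"
    using ineq by (meson add_nonneg_nonneg order_trans zero_le_power2)
  have "(\<Sum>k\<in>UNIV. vec_concurrence q {b} (\<mu> k))\<^sup>2 + (\<Sum>k\<in>UNIV. vec_concurrence q C (\<nu> k))\<^sup>2
      \<le> (vec_concurrence q (insert b C) \<phi>)\<^sup>2"
  proof -
    have "(2 * x)\<^sup>2 + (2 * y + 2 * z)\<^sup>2 = 4 * (x\<^sup>2 + (y + z)\<^sup>2)" for x y z :: real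
      by (simp add: power2_eq_square algebra_simps)
    moreover have "(2 * sqrt (Re (det2 (sandwich G id2))))\<^sup>2 = 4 * Re (det2 (sandwich G id2))"
      using pos by (simp add: power_mult_distrib)
    ultimately show ?thesis
      using ineq by (simp only: conc1 conc2 conc sum_bool w_def if_False if_True flip: sum_distrib_left) simp
  qed
  then show thesis using that ens1 ens2 by blast
qed

lemma monogamy:
  assumes S: "finite S" "{q} \<union> insert b C \<subseteq> S" and C: "q \<notin> C" "b \<notin> C" "q \<noteq> b"
    and \<rho>: "density_matrix S \<rho>"
  shows "(concurrence {q} {b} (reduced S ({q} \<union> {b}) \<rho>))\<^sup>2 + (concurrence {q} C (reduced S ({q} \<union> C) \<rho>))\<^sup>2
    \<le> (concurrence {q} (insert b C) (reduced S ({q} \<union> insert b C) \<rho>))\<^sup>2"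
proof -
  define T where "T = {q} \<union> insert b C"
  define \<sigma> where "\<sigma> = reduced S T \<rho>"
  have TS: "T \<subseteq> S" using S by (simp add: T_def)
  have finC: "finite C" using S finite_subset by auto
  have sub: "{q} \<union> {b} \<subseteq> T" "{q} \<union> C \<subseteq> T" by (auto simp: T_def)
  define \<rho>1 where "\<rho>1 = reduced T ({q} \<union> {b}) \<sigma>"
  define \<rho>2 where "\<rho>2 = reduced T ({q} \<union> C) \<sigma>"
  have red: "reduced S ({q} \<union> {b}) \<rho> = \<rho>1" "reduced S ({q} \<union> C) \<rho> = \<rho>2"
    unfolding \<rho>1_def \<rho>2_def \<sigma>_def reduced_reduced[OF sub(1) TS] reduced_reduced[OF sub(2) TS]
    by (rule refl)+
  have "op_trace S \<rho> = 1" using \<rho> by (simp add: density_matrix_def)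
  then have tr: "op_trace T \<sigma> = 1" "op_trace ({q} \<union> {b}) \<rho>1 = 1" "op_trace ({q} \<union> C) \<rho>2 = 1"
    unfolding \<rho>1_def \<rho>2_def \<sigma>_def op_trace_reduced[OF sub(1)] op_trace_reduced[OF sub(2)] op_trace_reduced[OF TS]
    by blast+
  obtain \<phi>0 where "ensemble S (basis_states S) \<phi>0 \<rho>"
    using ensemble_exists[OF S(1)] \<rho> by (auto simp: density_matrix_def)
  from ensemble_reduced[OF this TS] S(1)
  obtain J :: "(('a \<Rightarrow> bool) \<times> ('a \<Rightarrow> bool)) set" and \<xi> where finJ: "finite J" and ens\<sigma>: "ensemble T J \<xi> \<sigma>"
    unfolding \<sigma>_def by (metis finite_SigmaI finite_basis_states finite_Diff)
  note ens1 = ensemble_reduced[OF ens\<sigma> sub(1), folded \<rho>1_def]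
  note ens2 = ensemble_reduced[OF ens\<sigma> sub(2), folded \<rho>2_def]
  have finT: "finite T" using TS S(1) by (rule finite_subset)
  have fin1: "finite (J \<times> basis_states (T - ({q} \<union> {b})))" and fin2: "finite (J \<times> basis_states (T - ({q} \<union> C)))"
    using finJ finT by simp_all
  have nonneg: "0 \<le> concurrence {q} {b} \<rho>1" "0 \<le> concurrence {q} C \<rho>2"
    using concurrence_bounds(1)[OF _ fin1 _ ens1 tr(2)] concurrence_bounds(1)[OF finC fin2 C(1) ens2 tr(3)] C by auto
  \<comment> \<open>Complex numbers serve as R^2. Both components are nonnegative, so enlarging them
    enlarges the norm.\<close>
  let ?z = "Complex (concurrence {q} {b} \<rho>1) (concurrence {q} C \<rho>2)"
  have "cmod ?z \<le> concurrence {q} (insert b C) \<sigma>"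
  proof (rule concurrence_ge[OF _ finJ _ ens\<sigma>[unfolded T_def] tr(1)[unfolded T_def]])
    show "finite (insert b C)" "q \<notin> insert b C" using finC C by auto
    fix n and \<phi> :: "nat \<Rightarrow> 'a vec"
    assume "ensemble ({q} \<union> insert b C) {..<n} \<phi> \<sigma>"
    then have ens: "ensemble T {..<n} \<phi> \<sigma>" by (simp add: T_def)
    have "\<exists>\<mu> \<nu>. ensemble ({q} \<union> {b}) (UNIV :: (bool \<times> bool) set) \<mu> (reduced T ({q} \<union> {b}) (projector (\<phi> i)))
      \<and> ensemble ({q} \<union> C) (UNIV :: bool set) \<nu> (reduced T ({q} \<union> C) (projector (\<phi> i)))
      \<and> (\<Sum>k\<in>UNIV. vec_concurrence q {b} (\<mu> k))\<^sup>2 + (\<Sum>k\<in>UNIV. vec_concurrence q C (\<nu> k))\<^sup>2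
        \<le> (vec_concurrence q (insert b C) (\<phi> i))\<^sup>2" for i
      unfolding T_def by (rule pure_tradeoff[OF finC C, of "\<phi> i"]) blast
    then obtain \<mu> :: "nat \<Rightarrow> bool \<times> bool \<Rightarrow> 'a vec" and \<nu> :: "nat \<Rightarrow> bool \<Rightarrow> 'a vec"
      where \<mu>: "\<And>i. ensemble ({q} \<union> {b}) UNIV (\<mu> i) (reduced T ({q} \<union> {b}) (projector (\<phi> i)))"
        and \<nu>: "\<And>i. ensemble ({q} \<union> C) UNIV (\<nu> i) (reduced T ({q} \<union> C) (projector (\<phi> i)))"
        and le: "\<And>i. (\<Sum>k\<in>UNIV. vec_concurrence q {b} (\<mu> i k))\<^sup>2 + (\<Sum>k\<in>UNIV. vec_concurrence q C (\<nu> i k))\<^sup>2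
          \<le> (vec_concurrence q (insert b C) (\<phi> i))\<^sup>2"
      by metis
    define a where "a i = (\<Sum>k\<in>UNIV. vec_concurrence q {b} (\<mu> i k))" for i
    define c where "c i = (\<Sum>k\<in>UNIV. vec_concurrence q C (\<nu> i k))" for i
    have e1: "ensemble ({q} \<union> {b}) ({..<n} \<times> UNIV) (\<lambda>(i, k). \<mu> i k) \<rho>1"
      using \<mu> unfolding ensemble_def \<rho>1_def ensemble_reduced_sum[OF ens sub(1)]
      by (simp add: sum.cartesian_product case_prod_unfold)
    have "concurrence {q} {b} \<rho>1 \<le> (\<Sum>i\<in>{..<n} \<times> UNIV. vec_concurrence q {b} ((\<lambda>(i, k). \<mu> i k) i))"
      by (rule concurrence_le_ensemble[OF _ _ _ e1 tr(2)]) (use C in auto)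
    then have le1: "concurrence {q} {b} \<rho>1 \<le> (\<Sum>i<n. a i)"
      by (simp add: a_def sum.cartesian_product case_prod_unfold)
    have e2: "ensemble ({q} \<union> C) ({..<n} \<times> UNIV) (\<lambda>(i, k). \<nu> i k) \<rho>2"
      using \<nu> unfolding ensemble_def \<rho>2_def ensemble_reduced_sum[OF ens sub(2)]
      by (simp add: sum.cartesian_product case_prod_unfold)
    have "concurrence {q} C \<rho>2 \<le> (\<Sum>i\<in>{..<n} \<times> UNIV. vec_concurrence q C ((\<lambda>(i, k). \<nu> i k) i))"
      by (rule concurrence_le_ensemble[OF finC _ C(1) e2 tr(3)]) simp
    then have le2: "concurrence {q} C \<rho>2 \<le> (\<Sum>i<n. c i)"
      by (simp add: c_def sum.cartesian_product case_prod_unfold)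
    have "cmod ?z \<le> cmod (Complex (\<Sum>i<n. a i) (\<Sum>i<n. c i))"
      using nonneg le1 le2 by (auto simp: cmod_def intro!: add_mono power_mono)
    also have "Complex (\<Sum>i<n. a i) (\<Sum>i<n. c i) = (\<Sum>i<n. Complex (a i) (c i))"
      by (simp add: complex_eq_iff)
    also have "cmod \<dots> \<le> (\<Sum>i<n. cmod (Complex (a i) (c i)))" by (rule norm_sum)
    also have "\<dots> \<le> (\<Sum>i<n. vec_concurrence q (insert b C) (\<phi> i))"
    proof (rule sum_mono)
      fix i
      have "sqrt ((a i)\<^sup>2 + (c i)\<^sup>2) \<le> vec_concurrence q (insert b C) (\<phi> i)"
        by (intro real_le_lsqrt vec_concurrence_nonneg) (use le finC in \<open>auto simp: a_def c_def\<close>)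
      then show "cmod (Complex (a i) (c i)) \<le> vec_concurrence q (insert b C) (\<phi> i)"
        by (simp add: cmod_def)
    qed
    finally show "cmod ?z \<le> (\<Sum>i<n. vec_concurrence q (insert b C) (\<phi> i))" .
  qed
  then have "(cmod ?z)\<^sup>2 \<le> (concurrence {q} (insert b C) \<sigma>)\<^sup>2"
    by (intro power_mono) auto
  then show ?thesis
    unfolding red by (simp add: cmod_power2 \<sigma>_def T_def)
qed

lemma reduced_concurrence_bounds:
  assumes S: "finite S" "{q} \<union> Y \<subseteq> S" and q: "q \<notin> Y" and \<rho>: "density_matrix S \<rho>"
  shows "0 \<le> concurrence {q} Y (reduced S ({q} \<union> Y) \<rho>)" "concurrence {q} Y (reduced S ({q} \<union> Y) \<rho>) \<le> 1"
proof -
  have finY: "finite Y" using S finite_subset by auto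
  obtain \<phi>0 where "ensemble S (basis_states S) \<phi>0 \<rho>"
    using ensemble_exists[OF S(1)] \<rho> by (auto simp: density_matrix_def)
  note ens = ensemble_reduced[OF this S(2)]
  have fin: "finite (basis_states S \<times> basis_states (S - ({q} \<union> Y)))" using S(1) by simp
  have tr: "op_trace ({q} \<union> Y) (reduced S ({q} \<union> Y) \<rho>) = 1"
    using op_trace_reduced[OF S(2)] \<rho> by (simp add: density_matrix_def)
  show "0 \<le> concurrence {q} Y (reduced S ({q} \<union> Y) \<rho>)" "concurrence {q} Y (reduced S ({q} \<union> Y) \<rho>) \<le> 1"
    using concurrence_bounds[OF finY fin q ens tr] by auto
qed

section \<open>The power inequality and the hierarchy\<close>

text \<open>The derivative at t is mu (1 + t^(2 mu) - (1+t)^(mu-1)) / t^(mu+1). It is nonpositive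
  because t^(2 mu) <= t and 1 + t <= (1+t)^(mu-1); the latter is where mu >= 2, that is beta >= 4,
  comes in.\<close>

lemma powr_split_antimono:
  fixes \<mu> x k :: real
  assumes "2 \<le> \<mu>" "0 < x" "x \<le> k" "k \<le> 1"
  shows "((1 + k) powr \<mu> - 1) / k powr \<mu> + k powr \<mu>
       \<le> ((1 + x) powr \<mu> - 1) / x powr \<mu> + x powr \<mu>"
proof (rule DERIV_nonpos_imp_nonincreasing[OF assms(3)])
  fix t :: real assume "x \<le> t" "t \<le> k"
  then have t: "0 < t" "t \<le> 1" using assms by auto
  have "1 + t powr (2*\<mu>) \<le> 1 + t powr 1"
    using t assms by (intro add_left_mono powr_mono') auto
  also have "\<dots> = (1 + t) powr 1" using t by simp
  also have "\<dots> \<le> (1 + t) powr (\<mu> - 1)"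
    using t assms by (intro powr_mono) auto
  finally have key: "1 + t powr (2*\<mu>) - (1 + t) powr (\<mu> - 1) \<le> 0" by simp
  define D where "D = ((\<mu> * (1 + t) powr (\<mu> - 1)) * t powr \<mu> - ((1 + t) powr \<mu> - 1) * (\<mu> * t powr (\<mu> - 1)))
      / (t powr \<mu> * t powr \<mu>) + \<mu> * t powr (\<mu> - 1)"
  have der: "((\<lambda>x. ((1 + x) powr \<mu> - 1) / x powr \<mu> + x powr \<mu>) has_real_derivative D) (at t)"
    unfolding D_def using t by (auto intro!: derivative_eq_intros)
  define u where "u = (1 + t) powr (\<mu> - 1)"
  define w where "w = t powr (\<mu> - 1)"
  have 1: "(1 + t) powr \<mu> = (1 + t) * u" "t powr \<mu> = t * w"
    using t by (simp_all add: u_def w_def powr_mult_base)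
  have 2: "t powr (2*\<mu>) = (t * w) * (t * w)"
    using 1 by (metis mult_2 powr_add)
  have "w > 0" using t by (simp add: w_def)
  have "D = \<mu> * (1 + t powr (2*\<mu>) - u) / (t * t * w)"
    unfolding D_def 1 2 u_def[symmetric] w_def[symmetric]
    using t \<open>w > 0\<close> by (simp add: field_simps power2_eq_square)
  also have "\<dots> \<le> 0"
    using key t \<open>w > 0\<close> assms unfolding u_def[symmetric]
    by (intro divide_nonpos_pos mult_nonneg_nonpos) auto
  finally show "\<exists>y. ((\<lambda>x. ((1 + x) powr \<mu> - 1) / x powr \<mu> + x powr \<mu>) has_real_derivative y) (at t) \<and> y \<le> 0"
    using der by blast
qed

text \<open>With x = (b/a)^2 <= k the coefficient that is exact at x is at least its value
  \<open>M_const k \<beta>\<close> at k. The summand \<open>k powr (\<beta> / 2)\<close> of that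
  constant dominates x^mu and so keeps the coefficient nonnegative. The lemma serves both ranges of
  indices, with the pair and the rest concurrence in exchanged roles.\<close>

lemma powr_split_bound:
  fixes a b r k \<beta> :: real
  assumes k: "0 < k" "k \<le> 1" and \<beta>: "4 \<le> \<beta>"
    and nonneg: "0 \<le> a" "0 \<le> b" "0 \<le> r"
    and sq: "a\<^sup>2 + b\<^sup>2 \<le> r\<^sup>2" and ba: "b\<^sup>2 \<le> k * a\<^sup>2"
  shows "a powr \<beta> + (M_const k \<beta> - b powr \<beta> / a powr \<beta>) * b powr \<beta> \<le> r powr \<beta>" (is ?A)
    and "0 \<le> M_const k \<beta> - b powr \<beta> / a powr \<beta>" (is ?B)
proof -
  have M_ge: "k powr (\<beta>/2) \<le> M_const k \<beta>"
    using k \<beta> unfolding M_const_def by (simp add: ge_one_powr_ge_zero)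
  have ar: "a \<le> r"
    using sq nonneg by (metis add_increasing2 le_add_same_cancel1 order_trans power2_le_imp_le zero_le_power2)
  show ?A ?B
  proof (atomize(full), cases "b = 0")
    \<comment> \<open>This includes a = 0, which forces b = 0; the quotient of powers is then 0 and
      the claims reduce to a <= r and M >= 0.\<close>
    case True
    then show "?A \<and> ?B"
      using ar nonneg \<beta> M_ge k powr_mono2[of \<beta> a r] by (auto intro: order_trans[OF powr_ge_zero])
  next
    case False
    with nonneg have b: "b > 0" by simp
    with ba nonneg have a: "a > 0" by (cases "a = 0") auto
    define \<mu> where "\<mu> = \<beta> / 2"
    define x where "x = (b / a)\<^sup>2"
    have x: "0 < x" "x \<le> k"
      using a b ba by (auto simp: x_def power_divide divide_simps mult.commute)
    have sqp: "t powr \<beta> = (t\<^sup>2) powr \<mu>" if "t \<ge> 0" for t :: real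
      using that by (cases "t = 0") (auto simp: \<mu>_def powr_powr powr_numeral[symmetric] simp del: powr_numeral)
    have b2: "b\<^sup>2 = a\<^sup>2 * x" using a by (simp add: x_def power_divide)
    have bp: "b powr \<beta> = a powr \<beta> * x powr \<mu>"
      using a b x by (simp add: sqp b2 powr_mult)
    have ap: "a powr \<beta> > 0" using a by simp
    have q: "b powr \<beta> / a powr \<beta> = x powr \<mu>" using ap by (simp add: bp)
    have "x powr \<mu> \<le> k powr \<mu>" using x \<beta> by (intro powr_mono2) (auto simp: \<mu>_def)
    then have B: ?B using M_ge by (simp add: q \<mu>_def)
    have "M_const k \<beta> \<le> ((1 + x) powr \<mu> - 1) / x powr \<mu> + x powr \<mu>"
      using powr_split_antimono[of \<mu> x k] x k \<beta> by (simp add: M_const_def \<mu>_def)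
    then have "(M_const k \<beta> - x powr \<mu>) * x powr \<mu> \<le> ((1 + x) powr \<mu> - 1) / x powr \<mu> * x powr \<mu>"
      by (intro mult_right_mono) auto
    then have "1 + (M_const k \<beta> - x powr \<mu>) * x powr \<mu> \<le> (1 + x) powr \<mu>"
      using x by simp
    then have "a powr \<beta> * (1 + (M_const k \<beta> - x powr \<mu>) * x powr \<mu>) \<le> a powr \<beta> * (1 + x) powr \<mu>"
      by (intro mult_left_mono) auto
    also have "\<dots> = (a\<^sup>2 * (1 + x)) powr \<mu>"
      using a x by (simp add: sqp powr_mult)
    also have "\<dots> \<le> (r\<^sup>2) powr \<mu>"
      using sq b2 a x \<beta> by (intro powr_mono2) (auto simp: \<mu>_def algebra_simps)
    also have "\<dots> = r powr \<beta>" using nonneg by (simp add: sqp)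
    finally have ?A by (simp only: q) (simp add: bp algebra_simps)
    with B show "?A \<and> ?B" by blast
  qed
qed

text \<open>Up to \<open>m\<close> the coefficient multiplies the rest concurrence, so iteration
  accumulates products of the \<open>M_coeff\<close>. Beyond \<open>m\<close> it multiplies the pair
  concurrence while the rest keeps coefficient 1, so iteration gives a plain sum, which then
  dominates the product of the claim.\<close>

lemma hierarchy_of_monogamy:
  fixes k \<beta> :: real and N m :: nat and \<rho> :: "nat oper"
  assumes k: "0 < k" "k \<le> 1"
    and m: "1 \<le> m" "m \<le> N - 3" and N: "N \<ge> 4"
    and h1: "\<forall>i\<in>{1..m}. k * (C_pair N \<rho> i)\<^sup>2 \<ge> (C_rest N \<rho> (i + 1))\<^sup>2"
    and h2: "\<forall>j\<in>{m + 1..N - 2}. (C_pair N \<rho> j)\<^sup>2 \<le> k * (C_rest N \<rho> (j + 1))\<^sup>2"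
    and \<beta>: "\<beta> \<ge> 4"
    and pair0: "\<And>i. 1 \<le> i \<Longrightarrow> i < N \<Longrightarrow> 0 \<le> C_pair N \<rho> i"
    and rest0: "\<And>i. 1 \<le> i \<Longrightarrow> i < N \<Longrightarrow> 0 \<le> C_rest N \<rho> i"
    and rest1: "\<And>i. 1 \<le> i \<Longrightarrow> i < N \<Longrightarrow> C_rest N \<rho> i \<le> 1"
    and mono: "\<And>i. 1 \<le> i \<Longrightarrow> i \<le> N - 2 \<Longrightarrow> (C_pair N \<rho> i)\<^sup>2 + (C_rest N \<rho> (i+1))\<^sup>2 \<le> (C_rest N \<rho> i)\<^sup>2"
    and last: "C_rest N \<rho> (N - 1) = C_pair N \<rho> (N - 1)"
  shows "C_rest N \<rho> 1 powr \<beta> \<ge>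
    (\<Sum>i = 1..m - 1. (\<Prod>j = 1..i. M_coeff k \<beta> N \<rho> j) * C_pair N \<rho> (i + 1) powr \<beta>) +
    (\<Prod>i = 1..m. M_coeff k \<beta> N \<rho> i) *
      ((\<Prod>j = m + 1..N - 2. Q_coeff k \<beta> N \<rho> j * C_pair N \<rho> j powr \<beta>) + C_pair N \<rho> (N - 1) powr \<beta>)"
proof -
  let ?r = "\<lambda>i. C_rest N \<rho> i powr \<beta>" and ?c = "\<lambda>i. C_pair N \<rho> i powr \<beta>"
  let ?M = "M_coeff k \<beta> N \<rho>" and ?Q = "Q_coeff k \<beta> N \<rho>"
  have M: "?c i + ?M i * ?r (i+1) \<le> ?r i" "0 \<le> ?M i" if "i \<in> {1..m}" for i
  proof -
    have i: "1 \<le> i" "i < N" "i + 1 < N" "i \<le> N - 2" using that m N by auto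
    show "?c i + ?M i * ?r (i+1) \<le> ?r i" "0 \<le> ?M i"
      using powr_split_bound[OF k \<beta> pair0 rest0 rest0, of i "i+1" i] i mono[of i] h1 that
      unfolding M_coeff_def by auto
  qed
  have Q: "?r (i+1) + ?Q i * ?c i \<le> ?r i" "0 \<le> ?Q i" if "i \<in> {m+1..N-2}" for i
  proof -
    have i: "1 \<le> i" "i < N" "i + 1 < N" "i \<le> N - 2" using that m N by auto
    show "?r (i+1) + ?Q i * ?c i \<le> ?r i" "0 \<le> ?Q i"
      using powr_split_bound[OF k \<beta> rest0 pair0 rest0, of "i+1" i i] i mono[of i] h2 that
      unfolding Q_coeff_def by (auto simp: add.commute)
  qed
  have head: "(\<Sum>i = 1..n - 1. (\<Prod>j = 1..i. ?M j) * ?c (i + 1)) + (\<Prod>i = 1..n. ?M i) * ?r (n + 1) \<le> ?r 1"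
    if "1 \<le> n" "n \<le> m" for n
    using that
  proof (induction n rule: nat_induct_at_least)
    case base
    \<comment> \<open>The summand of \<open>C_pair N \<rho> 1\<close> is given up here: the sum of
      the claim starts with \<open>C_pair N \<rho> 2\<close>.\<close>
    have "?M 1 * ?r 2 \<le> ?r 1"
      using M(1)[of 1] base powr_ge_zero[of "C_pair N \<rho> 1" \<beta>] by (simp add: numeral_2_eq_2 del: powr_ge_zero)
    then show ?case by (simp add: numeral_2_eq_2)
  next
    case (Suc n)
    have "(\<Prod>i = 1..n. ?M i) * (?c (n+1) + ?M (n+1) * ?r (n+1+1)) \<le> (\<Prod>i = 1..n. ?M i) * ?r (n+1)"
      using Suc by (intro mult_left_mono M prod_nonneg) auto
    moreover have "(\<Sum>i = 1..Suc n - 1. (\<Prod>j = 1..i. ?M j) * ?c (i + 1))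
        = (\<Sum>i = 1..n - 1. (\<Prod>j = 1..i. ?M j) * ?c (i + 1)) + (\<Prod>j = 1..n. ?M j) * ?c (n + 1)"
      using Suc(1) by (cases n) auto
    ultimately show ?case using Suc by (simp add: algebra_simps)
  qed
  have tail: "?c (N - 1) + (\<Sum>j = i..N - 2. ?Q j * ?c j) \<le> ?r i" if "m + 1 \<le> i" "i \<le> N - 1" for i
    using that(2,1)
  proof (induction i rule: inc_induct)
    case base
    have "{N - 1..N - 2} = {}" using N by auto
    then show ?case using last by simp
  next
    case (step i)
    have "{i..N - 2} = insert i {Suc i..N - 2}" using step by auto
    moreover have "i \<in> {m+1..N-2}" using step by auto
    ultimately show ?case using step Q(1)[of i] by simp
  qed
  \<comment> \<open>each factor of the second product is at most \<open>1\<close>, so the product is at most the sum in \<open>tail\<close>\<close>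
  have Qc1: "?Q j * ?c j \<le> 1" if "j \<in> {m+1..N-2}" for j
  proof -
    have "?Q j * ?c j \<le> ?r j"
      using Q(1)[OF that] powr_ge_zero[of "C_rest N \<rho> (j+1)" \<beta>] by linarith
    also have "\<dots> \<le> 1 powr \<beta>" using that m N \<beta> rest0[of j] rest1[of j] by (intro powr_mono2) auto
    finally show ?thesis by simp
  qed
  have Qc0: "0 \<le> ?Q j * ?c j" if "j \<in> {m+1..N-2}" for j
    using Q(2)[OF that] by simp
  \<comment> \<open>\<open>m \<le> N - 3\<close> makes the index range nonempty. An empty product
    would be 1, whereas this one is bounded by its first factor and hence by the sum.\<close>
  have mem: "m + 1 \<in> {m+1..N-2}" and le: "m + 1 \<le> N - 1" using m N by auto
  have "(\<Prod>j = m + 1..N - 2. ?Q j * ?c j)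
      = (?Q (m+1) * ?c (m+1)) * (\<Prod>j\<in>{m + 1..N - 2} - {m+1}. ?Q j * ?c j)"
    using mem by (intro prod.remove) auto
  also have "\<dots> \<le> (?Q (m+1) * ?c (m+1)) * 1"
    using Qc0 Qc1 mem by (intro mult_left_mono prod_le_1) auto
  also have "\<dots> \<le> (\<Sum>j = m + 1..N - 2. ?Q j * ?c j)"
    using Qc0 mem by (simp, intro member_le_sum) auto
  finally have "(\<Prod>j = m + 1..N - 2. ?Q j * ?c j) + ?c (N - 1) \<le> ?r (m + 1)"
    using tail[OF order_refl le] by simp
  then have "(\<Prod>i = 1..m. ?M i) * ((\<Prod>j = m + 1..N - 2. ?Q j * ?c j) + ?c (N - 1)) \<le> (\<Prod>i = 1..m. ?M i) * ?r (m + 1)"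
    using M(2) by (intro mult_left_mono prod_nonneg) auto
  then show ?thesis using head[of m] m by linarith
qed

theorem theorem1:
  fixes k \<beta> :: real and N m :: nat and \<rho> :: "nat oper"
  assumes "0 < k" and "k \<le> 1"
    and "N \<ge> 4"
    and "density_matrix {..<N} \<rho>"
    and "1 \<le> m" and "m \<le> N - 3"
    and "\<forall>i\<in>{1..m}. k * (C_pair N \<rho> i)\<^sup>2 \<ge> (C_rest N \<rho> (i + 1))\<^sup>2"
    and "\<forall>j\<in>{m + 1..N - 2}. (C_pair N \<rho> j)\<^sup>2 \<le> k * (C_rest N \<rho> (j + 1))\<^sup>2"
    and "\<beta> \<ge> 4"
  shows "C_rest N \<rho> 1 powr \<beta> \<ge>
    (\<Sum>i = 1..m - 1. (\<Prod>j = 1..i. M_coeff k \<beta> N \<rho> j) * C_pair N \<rho> (i + 1) powr \<beta>) +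
    (\<Prod>i = 1..m. M_coeff k \<beta> N \<rho> i) *
      ((\<Prod>j = m + 1..N - 2. Q_coeff k \<beta> N \<rho> j * C_pair N \<rho> j powr \<beta>) + C_pair N \<rho> (N - 1) powr \<beta>)"
proof (rule hierarchy_of_monogamy[OF assms(1,2,5,6,3,7-9)])
  have pair: "C_pair N \<rho> i = concurrence {0} {i} (reduced {..<N} ({0} \<union> {i}) \<rho>)" for i
    by (simp add: C_pair_def insert_commute)
  show "0 \<le> C_pair N \<rho> i" if "1 \<le> i" "i < N" for i
    unfolding pair by (rule reduced_concurrence_bounds) (use assms(4) that in auto)
  show "0 \<le> C_rest N \<rho> i" if "1 \<le> i" "i < N" for i
    unfolding C_rest_def by (rule reduced_concurrence_bounds) (use assms(4) that in auto)
  show "C_rest N \<rho> i \<le> 1" if "1 \<le> i" "i < N" for i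
    unfolding C_rest_def by (rule reduced_concurrence_bounds) (use assms(4) that in auto)
  show "(C_pair N \<rho> i)\<^sup>2 + (C_rest N \<rho> (i + 1))\<^sup>2 \<le> (C_rest N \<rho> i)\<^sup>2" if "1 \<le> i" "i \<le> N - 2" for i
  proof -
    have eq: "{i..N - 1} = insert i {i + 1..N - 1}" using that by auto
    have "{0} \<union> insert i {i + 1..N - 1} \<subseteq> {..<N}" using assms(3) that by auto
    then show ?thesis
      unfolding pair C_rest_def eq by (rule monogamy[OF finite_lessThan]) (use assms(4) that in auto)
  qed
  show "C_rest N \<rho> (N - 1) = C_pair N \<rho> (N - 1)"
    by (simp add: pair C_rest_def)
qed

end
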